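(* Let $A(t)$ be a normal frame spanning a fanning curve in $Gr(n,\mathbb{R}^{kn})$ and let $H(t)$ be its horizontal derivative. The matrix of the Jacobi endomorphism $K(t)$ in the basis of $\mathbb{R}^{kn}$ formed by the columns of $(A(t)|\dot A(t)|\cdots|A^{(k-2)}(t)|H(t))$ is the $k\times k$ block matrix (with $n\times n$ blocks) $$\left(\begin{array}{cccccc} 0&0&\cdots&0&h_{k-2}-h_{k-3}'&0\\ 0&0&\cdots&0&\binom{k-1}{k-2}(h_{k-3}-h_{k-4}')&0\\ \vdots&\vdots& &\vdots&\vdots&\vdots\\ 0&0&\cdots&0&\binom{k-1}{2}(h_1-\kappa')&0\\ 0&0&\cdots&0&(k-1)\kappa&0\\ 0&0&\cdots&0&0&(k-1)\kappa\end{array}\right),$$ where $\kappa(t)=\frac12\{A(t),t\}$ and primes denote $d/dt$.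
   Context: Let $n\ge1$, $k\ge2$ be integers; all curves are smooth. A frame is a curve $A(t)$ of real $kn\times n$ matrices; it is fanning if $(A(t)|\dot A(t)|\cdots|A^{(k-1)}(t))$ is an invertible $kn\times kn$ matrix for all $t$. A curve $\ell(t)\in Gr(n,\mathbb{R}^{kn})$ is fanning if it is spanned by (is the column space of) a fanning frame. A fanning frame is normal if for every $t$ the columns of $A^{(k)}(t)$ are linear combinations of those of $A(t),\dots,A^{(k-2)}(t)$. A normal frame satisfies a unique equation $$A^{(k)}+\binom{k}{2}A^{(k-2)}\kappa+\binom{k}{3}A^{(k-3)}h_1+\cdots+\binom{k}{k}Ah_{k-2}=0$$ with smooth $n\times n$ matrix coefficients $\kappa,h_1,\dots,h_{k-2}$; this $\kappa$ equals $\frac12\{A(t),t\}$, where $\{A(t),t\}$ is called the Schwarzian of $A$. Convention: $h_0=\kappa$. The fundamental endomorphism $F(t)$ of a fanning frame is the linear map of $\mathbb{R}^{kn}$ with $F A=0$ and $F A^{(i)}=iA^{(i-1)}$ for $1\le i\le k-1$; it depends only on the spanned curve. The fundamental reflection is $D=\frac1k(2\dot F-(k-2)I)$; $P=\frac12(I-D)$ is the projection with image the vertical space $v(t)=\mathrm{Span}\{A(t),\dots,A^{(k-2)}(t)\}$ and its kernel is the horizontal curve $h(t)$. The horizontal derivative of $A$ is $H(t)=(I-P(t))A^{(k-1)}(t)$. The Jacobi endomorphism is $K(t)=\ddot F(t)^2/k^2=\dot P(t)^2$. The matrix $M$ of an endomorphism $L$ in the basis given by the columns of an invertible matrix $\mathbf{B}$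 is defined by $L\mathbf{B}=\mathbf{B}M$. In the displayed matrix, the only possibly nonzero blocks are: the $(k,k)$ and $(k-1,k-1)$ blocks, both $(k-1)\kappa$, and, in block column $k-1$, for $3\le j\le k$, the block in row $k-j+1$, equal to $\binom{k-1}{j-1}(h_{j-2}-h_{j-3}')$. *)

theory Defs
  imports "HOL-Analysis.Derivative" "Jordan_Normal_Form.VS_Connect"
begin

text \<open>
  Curves are functions of a real parameter t that are only looked at on an open interval T. An
  endomorphism of \<open>\<real>\<^bsup>kn\<^esup>\<close> is identified with its \<open>kn \<times> kn\<close> matrix in the standard basis.
\<close>

definition smooth_curve :: "nat \<Rightarrow> nat \<Rightarrow> real set \<Rightarrow> (real \<Rightarrow> real mat) \<Rightarrow> bool" where
  "smooth_curve r c T A \<longleftrightarrow>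
     (\<forall>t\<in>T. A t \<in> carrier_mat r c) \<and>
     (\<forall>i<r. \<forall>j<c. \<forall>m. \<forall>t\<in>T. (deriv ^^ m) (\<lambda>s. A s $$ (i, j)) differentiable (at t))"

definition mat_deriv :: "(real \<Rightarrow> real mat) \<Rightarrow> real \<Rightarrow> real mat" where
  "mat_deriv A t =
     Matrix.mat (dim_row (A t)) (dim_col (A t)) (\<lambda>(i, j). deriv (\<lambda>s. A s $$ (i, j)) t)"

abbreviation mat_nderiv :: "nat \<Rightarrow> (real \<Rightarrow> real mat) \<Rightarrow> real \<Rightarrow> real mat" where
  "mat_nderiv m A \<equiv> (mat_deriv ^^ m) A"

definition mat_sum :: "nat \<Rightarrow> nat \<Rightarrow> ('i \<Rightarrow> real mat) \<Rightarrow> 'i set \<Rightarrow> real mat" where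
  "mat_sum r c M S = Matrix.mat r c (\<lambda>(i, j). \<Sum>s\<in>S. M s $$ (i, j))"

text \<open>
  \<open>block_row r n m B\<close> is \<open>(B 0 | \<dots> | B (m - 1))\<close> with blocks of size \<open>r \<times> n\<close>.
\<close>

definition block_row :: "nat \<Rightarrow> nat \<Rightarrow> nat \<Rightarrow> (nat \<Rightarrow> real mat) \<Rightarrow> real mat" where
  "block_row r n m B = Matrix.mat r (m * n) (\<lambda>(i, j). B (j div n) $$ (i, j mod n))"

text \<open>
  \<open>block_mat k n M\<close> is the \<open>k \<times> k\<close> block matrix whose \<open>n \<times> n\<close> block in block row p and block
  column q is \<open>M p q\<close>; here p and q run through 1, ..., k.
\<close>

definition block_mat :: "nat \<Rightarrow> nat \<Rightarrow> (nat \<Rightarrow> nat \<Rightarrow> real mat) \<Rightarrow> real mat" where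
  "block_mat k n M = Matrix.mat (k * n) (k * n)
     (\<lambda>(i, j). M (i div n + 1) (j div n + 1) $$ (i mod n, j mod n))"

text \<open>M is the matrix of L in the basis of \<open>\<real>\<^bsup>N\<^esup>\<close> formed by the columns of B.\<close>

definition matrix_in_basis :: "nat \<Rightarrow> real mat \<Rightarrow> real mat \<Rightarrow> real mat \<Rightarrow> bool" where
  "matrix_in_basis N L B M \<longleftrightarrow>
     L \<in> carrier_mat N N \<and> B \<in> carrier_mat N N \<and> M \<in> carrier_mat N N \<and>
     invertible_mat B \<and> L * B = B * M"

definition fanning_frame :: "nat \<Rightarrow> nat \<Rightarrow> real set \<Rightarrow> (real \<Rightarrow> real mat) \<Rightarrow> bool" where
  "fanning_frame k n T A \<longleftrightarrow>
     smooth_curve (k * n) n T A \<and>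
     (\<forall>t\<in>T. invertible_mat (block_row (k * n) n k (\<lambda>i. mat_nderiv i A t)))"

definition normal_frame :: "nat \<Rightarrow> nat \<Rightarrow> real set \<Rightarrow> (real \<Rightarrow> real mat) \<Rightarrow> bool" where
  "normal_frame k n T A \<longleftrightarrow>
     fanning_frame k n T A \<and>
     (\<forall>t\<in>T. set (cols (mat_nderiv k A t)) \<subseteq>
        vec_space.col_space (k * n) (block_row (k * n) n (k - 1) (\<lambda>i. mat_nderiv i A t)))"

text \<open>
  \<open>normal_coeffs k n A t i\<close> is the matrix \<open>h\<^sub>i(t)\<close>, with \<open>h\<^sub>0 = \<kappa>\<close>, in
  \<open>A\<^bsup>(k)\<^esup> + \<Sum>\<^bsub>j=2..k\<^esub> (k choose j) A\<^bsup>(k-j)\<^esup> h\<^bsub>j-2\<^esub> = 0\<close>.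
  Indices beyond \<open>k - 2\<close> do not occur in the equation and get the value 0, so that the whole
  family is uniquely determined.
\<close>

definition normal_coeffs :: "nat \<Rightarrow> nat \<Rightarrow> (real \<Rightarrow> real mat) \<Rightarrow> real \<Rightarrow> nat \<Rightarrow> real mat" where
  "normal_coeffs k n A t = (THE h.
     (\<forall>i. h i \<in> carrier_mat n n) \<and> (\<forall>i>k - 2. h i = 0\<^sub>m n n) \<and>
     mat_nderiv k A t
       + mat_sum (k * n) n (\<lambda>j. real (k choose j) \<cdot>\<^sub>m (mat_nderiv (k - j) A t * h (j - 2))) {2..k}
     = 0\<^sub>m (k * n) n)"

text \<open>The Schwarzian \<open>{A(t), t}\<close> of a normal frame.\<close>

definition schwarzian :: "nat \<Rightarrow> nat \<Rightarrow> (real \<Rightarrow> real mat) \<Rightarrow> real \<Rightarrow> real mat" where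
  "schwarzian k n A t = 2 \<cdot>\<^sub>m normal_coeffs k n A t 0"

definition fundamental_endo :: "nat \<Rightarrow> nat \<Rightarrow> (real \<Rightarrow> real mat) \<Rightarrow> real \<Rightarrow> real mat" where
  "fundamental_endo k n A t = (THE F.
     F \<in> carrier_mat (k * n) (k * n) \<and>
     F * A t = 0\<^sub>m (k * n) n \<and>
     (\<forall>i\<in>{1..k - 1}. F * mat_nderiv i A t = real i \<cdot>\<^sub>m mat_nderiv (i - 1) A t))"

definition fundamental_reflection :: "nat \<Rightarrow> nat \<Rightarrow> (real \<Rightarrow> real mat) \<Rightarrow> real \<Rightarrow> real mat" where
  "fundamental_reflection k n A t =
     (1 / real k) \<cdot>\<^sub>m
       (2 \<cdot>\<^sub>m mat_deriv (fundamental_endo k n A) t - (real k - 2) \<cdot>\<^sub>m 1\<^sub>m (k * n))"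

definition vertical_proj :: "nat \<Rightarrow> nat \<Rightarrow> (real \<Rightarrow> real mat) \<Rightarrow> real \<Rightarrow> real mat" where
  "vertical_proj k n A t = (1 / 2) \<cdot>\<^sub>m (1\<^sub>m (k * n) - fundamental_reflection k n A t)"

definition horizontal_deriv :: "nat \<Rightarrow> nat \<Rightarrow> (real \<Rightarrow> real mat) \<Rightarrow> real \<Rightarrow> real mat" where
  "horizontal_deriv k n A t = (1\<^sub>m (k * n) - vertical_proj k n A t) * mat_nderiv (k - 1) A t"

definition jacobi_endo :: "nat \<Rightarrow> nat \<Rightarrow> (real \<Rightarrow> real mat) \<Rightarrow> real \<Rightarrow> real mat" where
  "jacobi_endo k n A t =
     (let F2 = mat_nderiv 2 (fundamental_endo k n A) t in (1 / (real k)\<^sup>2) \<cdot>\<^sub>m (F2 * F2))"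

text \<open>
  The displayed block matrix for a curve kappa and a family h of curves (the convention
  \<open>h 0 = kappa\<close> is up to the caller). The entry in block column \<open>k - 1\<close> and block row \<open>p \<le> k - 2\<close>
  is indexed by \<open>j = k - p + 1\<close>, so that \<open>3 \<le> j \<le> k\<close>.
\<close>

definition jacobi_block_mat ::
    "nat \<Rightarrow> nat \<Rightarrow> (real \<Rightarrow> real mat) \<Rightarrow> (nat \<Rightarrow> real \<Rightarrow> real mat) \<Rightarrow> real \<Rightarrow> real mat" where
  "jacobi_block_mat k n kappa h t = block_mat k n (\<lambda>p q.
     if p = q \<and> (p = k - 1 \<or> p = k) then (real k - 1) \<cdot>\<^sub>m kappa t
     else if q = k - 1 \<and> p \<le> k - 2 then
       (let j = k - p + 1 in
        real ((k - 1) choose (j - 1)) \<cdot>\<^sub>m (h (j - 2) t - mat_deriv (h (j - 3)) t))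
     else 0\<^sub>m n n)"

end

theory Submission
  imports Defs "Jordan_Normal_Form.Determinant"
begin

text \<open>
  Write \<open>a\<^sub>i\<close> for the i-th derivative of \<open>A\<close>. The matrix of the Jacobi endomorphism comes out by
  differentiating, twice, the relations \<open>F a\<^sub>i = i a\<^bsub>i-1\<^esub>\<close> that define the fundamental endomorphism.

  The first derivative of these relations is \<open>F' a\<^sub>i + F a\<^bsub>i+1\<^esub> = i a\<^sub>i\<close>. For \<open>i \<le> k - 2\<close> the second
  summand is \<open>(i + 1) a\<^sub>i\<close>, so \<open>F'\<close> is \<open>-1\<close> on the vertical space (\<open>F'_mult_a\<close>). For \<open>i = k - 1\<close>
  the summand \<open>F a\<^sub>k\<close> is known from the normal equation, and the result is
  \<open>F' a\<^bsub>k-1\<^esub> = k H - a\<^bsub>k-1\<^esub>\<close> with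
  \<open>H = a\<^bsub>k-1\<^esub> + \<Sum>\<^bsub>i\<le>k-3\<^esub> (k-1 choose i) a\<^sub>i h\<^bsub>k-3-i\<^esub>\<close>. Unfolding the definitions of the reflection and of
  the projection, this \<open>H\<close> is the horizontal derivative (\<open>horizontal_deriv_eq_H\<close>), and
  \<open>F' H = (k - 1) H\<close>.

  Differentiating \<open>F' a\<^sub>i = - a\<^sub>i\<close> shows that \<open>F''\<close> kills \<open>a\<^sub>0, ..., a\<^bsub>k-3\<^esub>\<close> and maps \<open>a\<^bsub>k-2\<^esub>\<close> to
  \<open>- k H\<close>. Differentiating \<open>F' H = (k - 1) H\<close> gives \<open>F'' H = k H'\<close>, because \<open>H'\<close> is vertical and
  therefore \<open>F' H' = - H'\<close>. Pascal's rule turns the normal equation into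
  \<open>H' = - \<Sum>\<^bsub>i\<le>k-2\<^esub> (k-1 choose i) a\<^sub>i (h\<^bsub>k-2-i\<^esub> - h'\<^bsub>k-3-i\<^esub>)\<close>, where the term \<open>h'\<^bsub>-1\<^esub>\<close> for \<open>i = k - 2\<close> is
  absent (\<open>H_has_deriv\<close>). Hence \<open>K = F''\<^sup>2 / k\<^sup>2\<close> kills \<open>a\<^sub>0, ..., a\<^bsub>k-3\<^esub>\<close>, maps \<open>a\<^bsub>k-2\<^esub>\<close> to \<open>- H'\<close>, whose
  coordinates are the second to last block column, and maps \<open>H\<close> to \<open>F'' H' / k = (k - 1) H \<kappa>\<close>.

  What makes this calculus legitimate is that \<open>F\<close> and the coefficients \<open>h\<^sub>i\<close>, which are defined
  pointwise as solutions of linear equations, are smooth in t. Both are obtained from smooth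
  curves by multiplication with the inverse of the frame matrix \<open>(A | A' | ... )\<close>, and inversion
  preserves smoothness by the adjugate formula (\<open>smooth_inverse_curve\<close>).

  Sums over the frame are indexed by the order i of the derivative \<open>a\<^sub>i\<close>; in the normal equation
  and in the displayed matrix the index is \<open>j = k - i\<close>.
\<close>

section \<open>Smooth functions on an open set\<close>

text \<open>
  The recursion strips the innermost derivative, so that an induction on the order applies its
  hypothesis to the derivative, for example to \<open>f' g + f g'\<close> for a product. Iterating \<open>deriv\<close> from
  the outside would require a formula for the higher derivatives of a product.
\<close>
primrec diff_times :: "real set \<Rightarrow> nat \<Rightarrow> (real \<Rightarrow> real) \<Rightarrow> bool" where
  "diff_times T 0 f \<longleftrightarrow> True"
| "diff_times T (Suc m) f \<longleftrightarrow> (\<forall>t\<in>T. f differentiable (at t)) \<and> diff_times T m (deriv f)"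

definition smooth_fun :: "real set \<Rightarrow> (real \<Rightarrow> real) \<Rightarrow> bool" where
  "smooth_fun T f \<longleftrightarrow> (\<forall>m. diff_times T m f)"

lemma diff_times_iff_iterated_deriv:
  "diff_times T m f \<longleftrightarrow> (\<forall>l<m. \<forall>t\<in>T. (deriv ^^ l) f differentiable (at t))"
proof (induction m arbitrary: f)
  case (Suc m)
  have "(\<forall>l<Suc m. Q l) \<longleftrightarrow> Q 0 \<and> (\<forall>l<m. Q (Suc l))" for Q :: "nat \<Rightarrow> bool"
    by (metis Suc_less_eq zero_less_Suc not0_implies_Suc)
  then show ?case
    by (simp add: Suc.IH funpow_swap1)
qed simp

lemma deriv_cong_open:
  assumes "open T" "t \<in> T" "\<And>s. s \<in> T \<Longrightarrow> f s = g s"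
  shows "deriv f t = (deriv g t :: real)"
  using assms by (intro deriv_cong_ev refl) (auto simp: eventually_nhds)

lemma diff_times_cong:
  assumes "open T" "\<And>s. s \<in> T \<Longrightarrow> f s = g s" "diff_times T m f"
  shows "diff_times T m g"
  using assms(2,3)
proof (induction m arbitrary: f g)
  case (Suc m)
  have "g differentiable (at t)" if t: "t \<in> T" for t
  proof -
    have "(f has_real_derivative deriv f t) (at t)"
      using Suc.prems(2) t by (simp add: DERIV_deriv_iff_real_differentiable)
    then have "(g has_real_derivative deriv f t) (at t)"
      using has_field_derivative_transform_within_open assms(1) t Suc.prems(1) by blast
    then show ?thesis
      using real_differentiable_def by blast
  qed
  moreover have "diff_times T m (deriv g)"
  proof (rule Suc.IH)
    show "deriv f s = deriv g s" if "s \<in> T" for s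
      by (rule deriv_cong_open[OF assms(1) that Suc.prems(1)])
    show "diff_times T m (deriv f)"
      using Suc.prems(2) by simp
  qed
  ultimately show ?case by simp
qed simp

text \<open>
  Any function that is a derivative on \<open>T\<close> may stand in for \<open>deriv f\<close>, whose values outside
  \<open>T\<close> are arbitrary.
\<close>
lemma diff_times_SucI:
  assumes "open T" "\<And>t. t \<in> T \<Longrightarrow> (f has_real_derivative f' t) (at t)" "diff_times T m f'"
  shows "diff_times T (Suc m) f"
proof -
  have "diff_times T m (deriv f)"
    by (rule diff_times_cong[OF assms(1) DERIV_imp_deriv[OF assms(2), symmetric] assms(3)])
  moreover have "f differentiable (at t)" if "t \<in> T" for t
    using assms(2)[OF that] real_differentiable_def by blast
  ultimately show ?thesis by simp
qed

lemma diff_times_SucD: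
  assumes "diff_times T (Suc m) f"
  shows "\<And>t. t \<in> T \<Longrightarrow> (f has_real_derivative deriv f t) (at t)" "diff_times T m (deriv f)"
  using assms by (auto simp: DERIV_deriv_iff_real_differentiable)

lemma diff_times_decrease: "diff_times T (Suc m) f \<Longrightarrow> diff_times T m f"
  by (auto simp: diff_times_iff_iterated_deriv)

lemma diff_times_const: "open T \<Longrightarrow> diff_times T m (\<lambda>t. c)"
  by (induction m arbitrary: c) (auto intro!: diff_times_SucI[where f' = "\<lambda>t. 0"])

lemma diff_times_add:
  assumes "open T"
  shows "diff_times T m f \<Longrightarrow> diff_times T m g \<Longrightarrow> diff_times T m (\<lambda>t. f t + g t)"
proof (induction m arbitrary: f g)
  case (Suc m)
  note f = diff_times_SucD[OF Suc.prems(1)] and g = diff_times_SucD[OF Suc.prems(2)]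
  show ?case
    by (rule diff_times_SucI[OF assms DERIV_add[OF f(1) g(1)] Suc.IH[OF f(2) g(2)]])
qed simp

lemma diff_times_mult:
  assumes "open T"
  shows "diff_times T m f \<Longrightarrow> diff_times T m g \<Longrightarrow> diff_times T m (\<lambda>t. f t * g t)"
proof (induction m arbitrary: f g)
  case (Suc m)
  note f = diff_times_SucD[OF Suc.prems(1)] and g = diff_times_SucD[OF Suc.prems(2)]
  note f0 = diff_times_decrease[OF Suc.prems(1)] and g0 = diff_times_decrease[OF Suc.prems(2)]
  show ?case
    by (rule diff_times_SucI[OF assms DERIV_mult[OF f(1) g(1)]
          diff_times_add[OF assms Suc.IH[OF f(2) g0] Suc.IH[OF g(2) f0]]])
qed simp

lemma diff_times_inverse:
  assumes "open T"
  shows "diff_times T m f \<Longrightarrow> (\<And>t. t \<in> T \<Longrightarrow> f t \<noteq> 0) \<Longrightarrow> diff_times T m (\<lambda>t. inverse (f t))"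
proof (induction m)
  case (Suc m)
  note f = diff_times_SucD[OF Suc.prems(1)]
  note f0 = Suc.IH[OF diff_times_decrease[OF Suc.prems(1)] Suc.prems(2)]
  have "((\<lambda>t. inverse (f t)) has_real_derivative (- 1 * deriv f t) * (inverse (f t) * inverse (f t)))
      (at t)" if "t \<in> T" for t
    by (rule DERIV_cong[OF DERIV_inverse_fun[OF f(1)[OF that] Suc.prems(2)[OF that]]])
      (simp add: numeral_2_eq_2)
  moreover have "diff_times T m (\<lambda>t. (- 1 * deriv f t) * (inverse (f t) * inverse (f t)))"
    using f(2) f0 by (intro diff_times_mult diff_times_const assms)
  ultimately show ?case
    by (rule diff_times_SucI[OF assms])
qed simp

lemma smooth_fun_cong:
  "open T \<Longrightarrow> (\<And>s. s \<in> T \<Longrightarrow> f s = g s) \<Longrightarrow> smooth_fun T f \<Longrightarrow> smooth_fun T g"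
  unfolding smooth_fun_def using diff_times_cong by blast

lemma smooth_fun_deriv: "smooth_fun T f \<Longrightarrow> smooth_fun T (deriv f)"
  unfolding smooth_fun_def using diff_times_SucD(2) by blast

lemma smooth_fun_const: "open T \<Longrightarrow> smooth_fun T (\<lambda>t. c)"
  by (simp add: smooth_fun_def diff_times_const)

lemma smooth_fun_add:
  "open T \<Longrightarrow> smooth_fun T f \<Longrightarrow> smooth_fun T g \<Longrightarrow> smooth_fun T (\<lambda>t. f t + g t)"
  by (simp add: smooth_fun_def diff_times_add)

lemma smooth_fun_mult:
  "open T \<Longrightarrow> smooth_fun T f \<Longrightarrow> smooth_fun T g \<Longrightarrow> smooth_fun T (\<lambda>t. f t * g t)"
  by (simp add: smooth_fun_def diff_times_mult)

lemma smooth_fun_inverse: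
  "open T \<Longrightarrow> smooth_fun T f \<Longrightarrow> (\<And>t. t \<in> T \<Longrightarrow> f t \<noteq> 0) \<Longrightarrow> smooth_fun T (\<lambda>t. inverse (f t))"
  by (simp add: smooth_fun_def diff_times_inverse)

lemma smooth_fun_sum:
  "open T \<Longrightarrow> (\<And>i. i \<in> S \<Longrightarrow> smooth_fun T (f i)) \<Longrightarrow> smooth_fun T (\<lambda>t. \<Sum>i\<in>S. f i t)"
  by (induction S rule: infinite_finite_induct) (auto intro: smooth_fun_const smooth_fun_add)

lemma smooth_fun_prod:
  "open T \<Longrightarrow> (\<And>i. i \<in> S \<Longrightarrow> smooth_fun T (f i)) \<Longrightarrow> smooth_fun T (\<lambda>t. \<Prod>i\<in>S. f i t)"
  by (induction S rule: infinite_finite_induct) (auto intro: smooth_fun_const smooth_fun_mult)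

section \<open>Entries and finite sums of matrices\<close>

lemma index_mult_mat_sum:
  assumes "A \<in> carrier_mat r c" "B \<in> carrier_mat c d" "i < r" "j < d"
  shows "(A * B) $$ (i, j) = (\<Sum>l = 0..<c. A $$ (i, l) * B $$ (l, j))"
  using assms by (simp add: scalar_prod_def)

text \<open>
  The entry rules for sums and scalar multiples have the dimensions as hypotheses. With the carrier
  as hypothesis they apply to products, whose entries are then left as they are.
\<close>
lemma index_smult_carrier:
  "M \<in> carrier_mat r c \<Longrightarrow> i < r \<Longrightarrow> j < c \<Longrightarrow> (x \<cdot>\<^sub>m M) $$ (i, j) = x * M $$ (i, j)"
  by simp

lemma index_add_carrier:
  fixes X :: "real mat"
  shows "X \<in> carrier_mat r c \<Longrightarrow> Y \<in> carrier_mat r c \<Longrightarrow> i < r \<Longrightarrow> j < c \<Longrightarrow>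
    (X + Y) $$ (i, j) = X $$ (i, j) + Y $$ (i, j)"
  by simp

lemma index_minus_carrier:
  fixes X :: "real mat"
  shows "X \<in> carrier_mat r c \<Longrightarrow> Y \<in> carrier_mat r c \<Longrightarrow> i < r \<Longrightarrow> j < c \<Longrightarrow>
    (X - Y) $$ (i, j) = X $$ (i, j) - Y $$ (i, j)"
  by simp

text \<open>
  Subtraction is expressed by the scalar \<open>-1\<close> so that the result can be compared with other linear
  combinations entry by entry.
\<close>
lemma add_eq_imp_eq:
  fixes X Y Z :: "real mat"
  assumes "X + Y = Z" "X \<in> carrier_mat r c" "Y \<in> carrier_mat r c"
  shows "X = Z + (- 1) \<cdot>\<^sub>m Y"
  using assms by (intro eq_matI) auto

lemma mat_sum_carrier [simp]: "mat_sum r c M S \<in> carrier_mat r c"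
  by (simp add: mat_sum_def)

lemma mat_sum_dim [simp]: "dim_row (mat_sum r c M S) = r" "dim_col (mat_sum r c M S) = c"
  by (simp_all add: mat_sum_def)

lemma index_mat_sum [simp]:
  "i < r \<Longrightarrow> j < c \<Longrightarrow> mat_sum r c M S $$ (i, j) = (\<Sum>s\<in>S. M s $$ (i, j))"
  by (simp add: mat_sum_def)

lemma mult_mat_sum:
  assumes "L \<in> carrier_mat p r" "\<And>s. s \<in> S \<Longrightarrow> M s \<in> carrier_mat r c"
  shows "L * mat_sum r c M S = mat_sum p c (\<lambda>s. L * M s) S"
proof (rule eq_matI)
  fix i j
  assume "i < dim_row (mat_sum p c (\<lambda>s. L * M s) S)" "j < dim_col (mat_sum p c (\<lambda>s. L * M s) S)"
  then have ij: "i < p" "j < c"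
    by auto
  have "(L * mat_sum r c M S) $$ (i, j) = (\<Sum>l = 0..<r. \<Sum>s\<in>S. L $$ (i, l) * M s $$ (l, j))"
    using index_mult_mat_sum[OF assms(1) mat_sum_carrier ij] ij by (simp add: sum_distrib_left)
  also have "\<dots> = (\<Sum>s\<in>S. \<Sum>l = 0..<r. L $$ (i, l) * M s $$ (l, j))"
    by (rule sum.swap)
  also have "\<dots> = (\<Sum>s\<in>S. (L * M s) $$ (i, j))"
    by (rule sum.cong) (use index_mult_mat_sum[OF assms(1) assms(2) ij] in auto)
  finally show "(L * mat_sum r c M S) $$ (i, j) = mat_sum p c (\<lambda>s. L * M s) S $$ (i, j)"
    using ij by simp
qed (use assms in auto)

lemma mat_sum_cong:
  "(\<And>s. s \<in> S \<Longrightarrow> M s = M' s) \<Longrightarrow> mat_sum r c M S = mat_sum r c M' S"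
  by (simp add: mat_sum_def)

lemma mat_sum_lessThan_Suc:
  "M m \<in> carrier_mat r c \<Longrightarrow> mat_sum r c M {..<Suc m} = mat_sum r c M {..<m} + M m"
  by (rule eq_matI) auto

lemma mat_sum_eq_zero:
  "(\<And>s. s \<in> S \<Longrightarrow> M s = 0\<^sub>m r c) \<Longrightarrow> mat_sum r c M S = 0\<^sub>m r c"
  by (rule eq_matI) auto

lemma smult_mat_sum:
  assumes "\<And>s. s \<in> S \<Longrightarrow> M s \<in> carrier_mat r c"
  shows "x \<cdot>\<^sub>m mat_sum r c M S = mat_sum r c (\<lambda>s. x \<cdot>\<^sub>m M s) S"
proof -
  have "x * M s $$ (i, j) = (x \<cdot>\<^sub>m M s) $$ (i, j)" if "s \<in> S" "i < r" "j < c" for s i j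
    using assms[OF that(1)] that(2,3) by simp
  then show ?thesis
    by (intro eq_matI) (simp_all add: sum_distrib_left)
qed

lemma mat_sum_delta:
  assumes "finite S" "q \<in> S" "X \<in> carrier_mat r c"
  shows "mat_sum r c (\<lambda>p. if p = q then X else 0\<^sub>m r c) S = X"
proof (rule eq_matI)
  fix i j
  assume "i < dim_row X" "j < dim_col X"
  then have ij: "i < r" "j < c"
    using assms(3) by auto
  then have "(if p = q then X else 0\<^sub>m r c) $$ (i, j) = (if p = q then X $$ (i, j) else 0)" for p
    by auto
  then show "mat_sum r c (\<lambda>p. if p = q then X else 0\<^sub>m r c) S $$ (i, j) = X $$ (i, j)"
    using ij assms by simp
qed (use assms(3) in auto)

section \<open>Smooth curves of matrices\<close>

lemma smooth_curve_iff_smooth_fun: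
  "smooth_curve r c T A \<longleftrightarrow> (\<forall>t\<in>T. A t \<in> carrier_mat r c) \<and>
     (\<forall>i<r. \<forall>j<c. smooth_fun T (\<lambda>s. A s $$ (i, j)))"
  unfolding smooth_curve_def smooth_fun_def diff_times_iff_iterated_deriv
  by (meson lessI)

lemma smooth_curveI:
  assumes "\<And>t. t \<in> T \<Longrightarrow> A t \<in> carrier_mat r c"
    and "\<And>i j. i < r \<Longrightarrow> j < c \<Longrightarrow> smooth_fun T (\<lambda>s. A s $$ (i, j))"
  shows "smooth_curve r c T A"
  using assms by (simp add: smooth_curve_iff_smooth_fun)

lemma smooth_curveD:
  assumes "smooth_curve r c T A"
  shows "\<And>t. t \<in> T \<Longrightarrow> A t \<in> carrier_mat r c"
    and "\<And>i j. i < r \<Longrightarrow> j < c \<Longrightarrow> smooth_fun T (\<lambda>s. A s $$ (i, j))"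
  using assms by (simp_all add: smooth_curve_iff_smooth_fun)

lemma smooth_curve_cong:
  assumes "open T" "\<And>s. s \<in> T \<Longrightarrow> A s = B s" "smooth_curve r c T A"
  shows "smooth_curve r c T B"
proof (rule smooth_curveI)
  show "smooth_fun T (\<lambda>s. B s $$ (i, j))" if "i < r" "j < c" for i j
    by (rule smooth_fun_cong[OF assms(1) _ smooth_curveD(2)[OF assms(3) that]]) (simp add: assms(2))
qed (use assms smooth_curveD(1) in fastforce)

lemma smooth_curve_mat_deriv:
  assumes "open T" "smooth_curve r c T A"
  shows "smooth_curve r c T (mat_deriv A)"
proof (rule smooth_curveI)
  show "mat_deriv A t \<in> carrier_mat r c" if "t \<in> T" for t
    using smooth_curveD(1)[OF assms(2) that] by (simp add: mat_deriv_def)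
  show "smooth_fun T (\<lambda>s. mat_deriv A s $$ (i, j))" if "i < r" "j < c" for i j
  proof (rule smooth_fun_cong[OF assms(1)])
    show "smooth_fun T (deriv (\<lambda>s. A s $$ (i, j)))"
      by (intro smooth_fun_deriv smooth_curveD(2)[OF assms(2) that])
    show "deriv (\<lambda>s. A s $$ (i, j)) t = mat_deriv A t $$ (i, j)" if "t \<in> T" for t
      using smooth_curveD(1)[OF assms(2) that] \<open>i < r\<close> \<open>j < c\<close> by (simp add: mat_deriv_def)
  qed
qed

lemma smooth_curve_mat_nderiv:
  "open T \<Longrightarrow> smooth_curve r c T A \<Longrightarrow> smooth_curve r c T (mat_nderiv m A)"
  by (induction m) (auto intro: smooth_curve_mat_deriv)

lemma smooth_curve_mult:
  assumes "open T" "smooth_curve r c T A" "smooth_curve c d T B"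
  shows "smooth_curve r d T (\<lambda>t. A t * B t)"
proof (rule smooth_curveI)
  show "A t * B t \<in> carrier_mat r d" if "t \<in> T" for t
    using smooth_curveD(1)[OF assms(2) that] smooth_curveD(1)[OF assms(3) that] by simp
  show "smooth_fun T (\<lambda>s. (A s * B s) $$ (i, j))" if ij: "i < r" "j < d" for i j
  proof (rule smooth_fun_cong[OF assms(1)])
    show "(\<Sum>l = 0..<c. A t $$ (i, l) * B t $$ (l, j)) = (A t * B t) $$ (i, j)" if "t \<in> T" for t
      using index_mult_mat_sum[OF smooth_curveD(1)[OF assms(2) that]
          smooth_curveD(1)[OF assms(3) that] ij] by simp
    show "smooth_fun T (\<lambda>t. \<Sum>l = 0..<c. A t $$ (i, l) * B t $$ (l, j))"
      using ij by (intro smooth_fun_sum smooth_fun_mult assms(1) smooth_curveD(2)[OF assms(2)]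
          smooth_curveD(2)[OF assms(3)]) auto
  qed
qed

lemma smooth_curve_smult:
  assumes "open T" "smooth_curve r c T A"
  shows "smooth_curve r c T (\<lambda>t. x \<cdot>\<^sub>m A t)"
proof (rule smooth_curveI)
  show "smooth_fun T (\<lambda>s. (x \<cdot>\<^sub>m A s) $$ (i, j))" if ij: "i < r" "j < c" for i j
  proof (rule smooth_fun_cong[OF assms(1)])
    show "smooth_fun T (\<lambda>s. x * A s $$ (i, j))"
      by (intro smooth_fun_mult smooth_fun_const assms(1) smooth_curveD(2)[OF assms(2) ij])
    show "x * A s $$ (i, j) = (x \<cdot>\<^sub>m A s) $$ (i, j)" if "s \<in> T" for s
      using smooth_curveD(1)[OF assms(2) that] ij by simp
  qed
qed (use smooth_curveD(1)[OF assms(2)] in auto)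

lemma smooth_fun_det:
  assumes "open T" "smooth_curve N N T B"
  shows "smooth_fun T (\<lambda>t. det (B t))"
proof (rule smooth_fun_cong[OF assms(1)])
  show "(\<Sum>p \<in> {p. p permutes {0..<N}}. signof p * (\<Prod>i = 0..<N. B t $$ (i, p i))) = det (B t)"
    if "t \<in> T" for t
    using det_def'[OF smooth_curveD(1)[OF assms(2) that]] by simp
  show "smooth_fun T (\<lambda>t. \<Sum>p \<in> {p. p permutes {0..<N}}. signof p * (\<Prod>i = 0..<N. B t $$ (i, p i)))"
  proof (intro smooth_fun_sum smooth_fun_mult smooth_fun_prod smooth_fun_const assms(1)
        smooth_curveD(2)[OF assms(2)])
    fix p i
    assume "p \<in> {p. p permutes {0..<N}}" "i \<in> {0..<N}"
    then show "p i < N"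
      using permutes_in_image[of p "{0..<N}" i] by simp
  qed auto
qed

lemma smooth_curve_mat_delete:
  assumes "open T" "smooth_curve N N T B"
  shows "smooth_curve (N - 1) (N - 1) T (\<lambda>t. mat_delete (B t) i j)"
proof (rule smooth_curveI)
  show "mat_delete (B t) i j \<in> carrier_mat (N - 1) (N - 1)" if "t \<in> T" for t
    by (rule mat_delete_carrier[OF smooth_curveD(1)[OF assms(2) that]])
  fix p q
  assume pq: "p < N - 1" "q < N - 1"
  let ?p = "if p < i then p else Suc p" and ?q = "if q < j then q else Suc q"
  show "smooth_fun T (\<lambda>s. mat_delete (B s) i j $$ (p, q))"
  proof (rule smooth_fun_cong[OF assms(1)])
    show "smooth_fun T (\<lambda>s. B s $$ (?p, ?q))"
      using pq by (intro smooth_curveD(2)[OF assms(2)]) auto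
    show "B s $$ (?p, ?q) = mat_delete (B s) i j $$ (p, q)" if "s \<in> T" for s
      using smooth_curveD(1)[OF assms(2) that] pq by (simp add: mat_delete_def)
  qed
qed

lemma invertible_mat_det_nonzero:
  fixes B :: "real mat"
  assumes "invertible_mat B" "B \<in> carrier_mat N N"
  shows "det B \<noteq> 0"
proof -
  obtain C where C: "B * C = 1\<^sub>m N" "C * B = 1\<^sub>m (dim_row C)"
    using assms by (auto simp: invertible_mat_def inverts_mat_def)
  have "dim_col C = N"
    using arg_cong[OF C(1), of dim_col] by simp
  moreover have "dim_row C = N"
    using arg_cong[OF C(2), of dim_col] assms(2) by simp
  ultimately have "det B * det C = 1"
    using det_mult[OF assms(2), of C] C(1) by auto
  then show ?thesis by auto
qed

text \<open>
  The inverse is \<open>adj B / det B\<close>; determinant and cofactors are polynomials in the entries of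
  \<open>B\<close>, and the determinant has no zero on \<open>T\<close>.
\<close>
lemma smooth_inverse_curve:
  assumes "open T" "smooth_curve N N T B" "\<And>t. t \<in> T \<Longrightarrow> invertible_mat (B t)"
  obtains C where "smooth_curve N N T C" "\<And>t. t \<in> T \<Longrightarrow> B t * C t = 1\<^sub>m N"
    "\<And>t. t \<in> T \<Longrightarrow> C t * B t = 1\<^sub>m N"
proof
  let ?C = "\<lambda>t. inverse (det (B t)) \<cdot>\<^sub>m adj_mat (B t)"
  have det: "det (B t) \<noteq> 0" if "t \<in> T" for t
    by (rule invertible_mat_det_nonzero[OF assms(3) smooth_curveD(1)[OF assms(2)]]) (fact that)+
  have B: "B t \<in> carrier_mat N N" if "t \<in> T" for t
    by (rule smooth_curveD(1)[OF assms(2) that])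
  show "B t * ?C t = 1\<^sub>m N" "?C t * B t = 1\<^sub>m N" if "t \<in> T" for t
    using adj_mat[OF B[OF that]] det[OF that] B[OF that]
    by (simp_all add: mult_smult_distrib[of _ N N _ N] mult_smult_assoc_mat[of _ N N _ N])
      (rule eq_matI, simp_all)+
  show "smooth_curve N N T ?C"
  proof (rule smooth_curveI)
    show "?C t \<in> carrier_mat N N" if "t \<in> T" for t
      using adj_mat(1)[OF B[OF that]] by simp
    fix i j
    assume ij: "i < N" "j < N"
    show "smooth_fun T (\<lambda>s. ?C s $$ (i, j))"
    proof (rule smooth_fun_cong[OF assms(1)])
      show "smooth_fun T (\<lambda>s. inverse (det (B s)) * ((- 1) ^ (j + i) * det (mat_delete (B s) j i)))"
        by (intro smooth_fun_mult smooth_fun_inverse smooth_fun_const smooth_fun_det[of _ N]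
            smooth_fun_det[OF _ smooth_curve_mat_delete, of _ N] assms det)
      show "inverse (det (B s)) * ((- 1) ^ (j + i) * det (mat_delete (B s) j i)) = ?C s $$ (i, j)"
        if "s \<in> T" for s
        using B[OF that] ij by (simp add: adj_mat_def cofactor_def)
    qed
  qed
qed

section \<open>Differentiating identities between matrix curves\<close>

text \<open>
  A relation between a curve and its derivative, on all of \<open>T\<close>. An identity between two matrix
  curves is differentiated by computing such a derivative for either side with the rules below
  and comparing them by \<open>has_mat_deriv_unique\<close>.
\<close>
definition has_mat_deriv ::
    "nat \<Rightarrow> nat \<Rightarrow> real set \<Rightarrow> (real \<Rightarrow> real mat) \<Rightarrow> (real \<Rightarrow> real mat) \<Rightarrow> bool" where
  "has_mat_deriv r c T A D \<longleftrightarrow> (\<forall>t\<in>T. A t \<in> carrier_mat r c \<and> D t \<in> carrier_mat r c \<and>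
     (\<forall>i<r. \<forall>j<c. ((\<lambda>s. A s $$ (i, j)) has_real_derivative D t $$ (i, j)) (at t)))"

lemma has_mat_derivD:
  assumes "has_mat_deriv r c T A D" "t \<in> T"
  shows "A t \<in> carrier_mat r c" "D t \<in> carrier_mat r c"
    "i < r \<Longrightarrow> j < c \<Longrightarrow> ((\<lambda>s. A s $$ (i, j)) has_real_derivative D t $$ (i, j)) (at t)"
  using assms by (auto simp: has_mat_deriv_def)

lemma has_mat_deriv_mat_deriv:
  assumes "smooth_curve r c T A"
  shows "has_mat_deriv r c T A (mat_deriv A)"
proof -
  have "((\<lambda>s. A s $$ (i, j)) has_real_derivative mat_deriv A t $$ (i, j)) (at t)"
    if "t \<in> T" "i < r" "j < c" for t i j
  proof -
    have "diff_times T (Suc 0) (\<lambda>s. A s $$ (i, j))"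
      using smooth_curveD(2)[OF assms that(2,3)] unfolding smooth_fun_def ..
    from diff_times_SucD(1)[OF this that(1)] show ?thesis
      using smooth_curveD(1)[OF assms that(1)] that by (simp add: mat_deriv_def)
  qed
  moreover have "mat_deriv A t \<in> carrier_mat r c" if "t \<in> T" for t
    using smooth_curveD(1)[OF assms that] by (simp add: mat_deriv_def)
  ultimately show ?thesis
    using smooth_curveD(1)[OF assms] by (simp add: has_mat_deriv_def)
qed

lemma has_mat_deriv_unique:
  assumes "has_mat_deriv r c T A D" "has_mat_deriv r c T B E" "open T"
    and "\<And>t. t \<in> T \<Longrightarrow> A t = B t" and t: "t \<in> T"
  shows "D t = E t"
proof (rule eq_matI)
  fix i j
  assume "i < dim_row (E t)" "j < dim_col (E t)"
  then have ij: "i < r" "j < c"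
    using has_mat_derivD(2)[OF assms(2) t] by auto
  have "((\<lambda>s. B s $$ (i, j)) has_real_derivative D t $$ (i, j)) (at t)"
    by (rule has_field_derivative_transform_within_open[OF has_mat_derivD(3)[OF assms(1) t ij] assms(3) t])
      (simp add: assms(4))
  then show "D t $$ (i, j) = E t $$ (i, j)"
    using has_mat_derivD(3)[OF assms(2) t ij] DERIV_unique by blast
qed (use has_mat_derivD(2)[OF assms(1) t] has_mat_derivD(2)[OF assms(2) t] in auto)

lemma has_mat_deriv_cong:
  assumes "open T" "\<And>t. t \<in> T \<Longrightarrow> A t = B t" "\<And>t. t \<in> T \<Longrightarrow> D t = E t" "has_mat_deriv r c T A D"
  shows "has_mat_deriv r c T B E"
proof -
  have "((\<lambda>s. B s $$ (i, j)) has_real_derivative E t $$ (i, j)) (at t)"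
    if t: "t \<in> T" and ij: "i < r" "j < c" for t i j
    using has_field_derivative_transform_within_open[OF has_mat_derivD(3)[OF assms(4) t ij] assms(1) t,
        of "\<lambda>s. B s $$ (i, j)"] assms(2,3) t by simp
  then show ?thesis
    using has_mat_derivD(1,2)[OF assms(4)] assms(2,3) by (simp add: has_mat_deriv_def)
qed

lemma has_mat_deriv_add:
  assumes "open T" "has_mat_deriv r c T A D" "has_mat_deriv r c T B E"
  shows "has_mat_deriv r c T (\<lambda>t. A t + B t) (\<lambda>t. D t + E t)"
proof -
  have "((\<lambda>s. (A s + B s) $$ (i, j)) has_real_derivative (D t + E t) $$ (i, j)) (at t)"
    if t: "t \<in> T" and ij: "i < r" "j < c" for t i j
    using has_field_derivative_transform_within_open[OF
        DERIV_add[OF has_mat_derivD(3)[OF assms(2) t ij] has_mat_derivD(3)[OF assms(3) t ij]]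
        assms(1) t, of "\<lambda>s. (A s + B s) $$ (i, j)"]
      has_mat_derivD(1,2)[OF assms(2)] has_mat_derivD(1,2)[OF assms(3)] ij t by fastforce
  then show ?thesis
    using has_mat_derivD(1,2)[OF assms(2)] has_mat_derivD(1,2)[OF assms(3)]
    by (simp add: has_mat_deriv_def)
qed

lemma has_mat_deriv_smult:
  assumes "open T" "has_mat_deriv r c T A D"
  shows "has_mat_deriv r c T (\<lambda>t. x \<cdot>\<^sub>m A t) (\<lambda>t. x \<cdot>\<^sub>m D t)"
proof -
  have "((\<lambda>s. (x \<cdot>\<^sub>m A s) $$ (i, j)) has_real_derivative (x \<cdot>\<^sub>m D t) $$ (i, j)) (at t)"
    if t: "t \<in> T" and ij: "i < r" "j < c" for t i j
    using has_field_derivative_transform_within_open[OF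
        DERIV_cmult[OF has_mat_derivD(3)[OF assms(2) t ij]]
        assms(1) t, of x "\<lambda>s. (x \<cdot>\<^sub>m A s) $$ (i, j)"]
      has_mat_derivD(1,2)[OF assms(2)] ij t by fastforce
  then show ?thesis
    using has_mat_derivD(1,2)[OF assms(2)] by (simp add: has_mat_deriv_def)
qed

lemma has_mat_deriv_mat_sum:
  assumes "\<And>s. s \<in> S \<Longrightarrow> has_mat_deriv r c T (M s) (D s)"
  shows "has_mat_deriv r c T (\<lambda>t. mat_sum r c (\<lambda>s. M s t) S) (\<lambda>t. mat_sum r c (\<lambda>s. D s t) S)"
  using has_mat_derivD(3)[OF assms] by (auto simp: has_mat_deriv_def intro!: DERIV_sum)

lemma has_mat_deriv_mult:
  assumes "open T" "has_mat_deriv r c T A D" "has_mat_deriv c d T B E"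
  shows "has_mat_deriv r d T (\<lambda>t. A t * B t) (\<lambda>t. D t * B t + A t * E t)"
proof -
  note A = has_mat_derivD[OF assms(2)] and B = has_mat_derivD[OF assms(3)]
  have "((\<lambda>s. (A s * B s) $$ (i, j)) has_real_derivative (D t * B t + A t * E t) $$ (i, j)) (at t)"
    if t: "t \<in> T" and ij: "i < r" "j < d" for t i j
  proof (rule has_field_derivative_transform_within_open[OF _ assms(1) t])
    show "(\<Sum>l = 0..<c. A s $$ (i, l) * B s $$ (l, j)) = (A s * B s) $$ (i, j)" if "s \<in> T" for s
      using index_mult_mat_sum[OF A(1)[OF that] B(1)[OF that] ij] by simp
    have "((\<lambda>s. \<Sum>l = 0..<c. A s $$ (i, l) * B s $$ (l, j)) has_real_derivative
        (\<Sum>l = 0..<c. D t $$ (i, l) * B t $$ (l, j) + E t $$ (l, j) * A t $$ (i, l))) (at t)"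
      using ij t by (intro DERIV_sum DERIV_mult A(3) B(3)) auto
    moreover have "(D t * B t + A t * E t) $$ (i, j) =
        (\<Sum>l = 0..<c. D t $$ (i, l) * B t $$ (l, j) + E t $$ (l, j) * A t $$ (i, l))"
      using index_mult_mat_sum[OF A(2)[OF t] B(1)[OF t] ij]
        index_mult_mat_sum[OF A(1)[OF t] B(2)[OF t] ij] A(1,2)[OF t] B(1,2)[OF t] ij
      by (simp add: sum.distrib mult.commute)
    ultimately show "((\<lambda>s. \<Sum>l = 0..<c. A s $$ (i, l) * B s $$ (l, j)) has_real_derivative
        (D t * B t + A t * E t) $$ (i, j)) (at t)"
      by simp
  qed
  moreover have "A t * B t \<in> carrier_mat r d" "D t * B t + A t * E t \<in> carrier_mat r d"
    if "t \<in> T" for t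
    using A(1,2)[OF that] B(1,2)[OF that] by auto
  ultimately show ?thesis
    by (simp add: has_mat_deriv_def)
qed

section \<open>Block matrices\<close>

lemma block_row_carrier [simp]: "block_row r n m B \<in> carrier_mat r (m * n)"
  by (simp add: block_row_def)

lemma block_mat_carrier [simp]: "block_mat k n M \<in> carrier_mat (k * n) (k * n)"
  by (simp add: block_mat_def)

lemma block_index_bound: "i < m \<Longrightarrow> a < n \<Longrightarrow> i * n + a < m * (n::nat)"
  by (metis add.commute mult.commute mult_less_cancel2 nat_mult_le_cancel_disj Suc_leI
      add_less_cancel_left less_le_trans mult_Suc_right)

lemma block_index_split: "(j::nat) < m * n \<Longrightarrow> j div n < m \<and> j mod n < n"
  by (cases "n = 0") (auto simp: less_mult_imp_div_less)

lemma block_row_cong: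
  "(\<And>i. i < m \<Longrightarrow> B i = B' i) \<Longrightarrow> block_row r n m B = block_row r n m B'"
  unfolding block_row_def by (rule eq_matI) (auto simp: block_index_split)

lemma block_row_inject:
  assumes eq: "block_row r n m B = block_row r n m B'" and "i < m"
    and "B i \<in> carrier_mat r n" "B' i \<in> carrier_mat r n"
  shows "B i = B' i"
proof (rule eq_matI)
  fix p q
  assume "p < dim_row (B' i)" "q < dim_col (B' i)"
  then have pq: "p < r" "q < n"
    using assms(4) by auto
  have "block_row r n m B $$ (p, i * n + q) = block_row r n m B' $$ (p, i * n + q)"
    by (simp add: eq)
  then show "B i $$ (p, q) = B' i $$ (p, q)"
    using pq block_index_bound[OF assms(2) pq(2)] by (simp add: block_row_def)
qed (use assms in auto)

lemma mult_block_row: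
  assumes "L \<in> carrier_mat p r" "\<And>i. i < m \<Longrightarrow> B i \<in> carrier_mat r n"
  shows "L * block_row r n m B = block_row p n m (\<lambda>i. L * B i)"
proof (rule eq_matI)
  fix i j
  assume "i < dim_row (block_row p n m (\<lambda>i. L * B i))" "j < dim_col (block_row p n m (\<lambda>i. L * B i))"
  then have ij: "i < p" "j < m * n"
    by (auto simp: block_row_def)
  note j = block_index_split[OF ij(2)]
  show "(L * block_row r n m B) $$ (i, j) = block_row p n m (\<lambda>i. L * B i) $$ (i, j)"
    using index_mult_mat_sum[OF assms(1) block_row_carrier ij]
      index_mult_mat_sum[OF assms(1) assms(2) ij(1)] j ij
    by (simp add: block_row_def)
qed (use assms in \<open>auto simp: block_row_def\<close>)

lemma sum_blocks: "(\<Sum>l = 0..<m * n. f l) = (\<Sum>i<m. \<Sum>a = 0..<n. f (i * n + a :: nat))"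
proof -
  have "(\<Sum>a = 0..<n. f (i * n + a)) = sum f {i * n..<i * n + n}" for i
    using sum.shift_bounds_nat_ivl[of f 0 "i * n" n] by (simp add: add.commute)
  then show ?thesis
    by (simp add: sum.nat_group lessThan_atLeast0[symmetric])
qed

definition block_col :: "nat \<Rightarrow> nat \<Rightarrow> nat \<Rightarrow> (nat \<Rightarrow> real mat) \<Rightarrow> real mat" where
  "block_col m n c X = Matrix.mat (m * n) c (\<lambda>(i, j). X (i div n) $$ (i mod n, j))"

definition row_slice :: "nat \<Rightarrow> nat \<Rightarrow> real mat \<Rightarrow> real mat" where
  "row_slice n i X = Matrix.mat n (dim_col X) (\<lambda>(a, j). X $$ (i * n + a, j))"

lemma block_col_carrier [simp]: "block_col m n c X \<in> carrier_mat (m * n) c"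
  by (simp add: block_col_def)

lemma row_slice_carrier: "X \<in> carrier_mat (m * n) c \<Longrightarrow> row_slice n i X \<in> carrier_mat n c"
  by (simp add: row_slice_def)

lemma row_slice_block_col:
  assumes "i < m" "X i \<in> carrier_mat n c"
  shows "row_slice n i (block_col m n c X) = X i"
  using assms block_index_bound[OF assms(1)]
  by (intro eq_matI) (auto simp: row_slice_def block_col_def)

lemma block_col_row_slice:
  assumes "X \<in> carrier_mat (m * n) c"
  shows "block_col m n c (\<lambda>i. row_slice n i X) = X"
  using assms block_index_split[of _ m n]
  by (intro eq_matI) (auto simp: row_slice_def block_col_def)

text \<open>
  This turns the linear combination \<open>\<Sum>\<^sub>i B\<^sub>i X\<^sub>i\<close> of blocks with matrix coefficients into a single
  matrix product, so that its coefficients can be recovered by inverting the block row.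
\<close>
lemma block_row_mult_block_col:
  assumes "\<And>i. i < m \<Longrightarrow> B i \<in> carrier_mat r n" "\<And>i. i < m \<Longrightarrow> X i \<in> carrier_mat n c"
  shows "block_row r n m B * block_col m n c X = mat_sum r c (\<lambda>i. B i * X i) {..<m}"
proof (rule eq_matI)
  fix p q
  assume "p < dim_row (mat_sum r c (\<lambda>i. B i * X i) {..<m})"
    "q < dim_col (mat_sum r c (\<lambda>i. B i * X i) {..<m})"
  then have pq: "p < r" "q < c"
    by auto
  have "(block_row r n m B * block_col m n c X) $$ (p, q) =
      (\<Sum>i<m. \<Sum>a = 0..<n. block_row r n m B $$ (p, i * n + a) * block_col m n c X $$ (i * n + a, q))"
    using index_mult_mat_sum[OF block_row_carrier block_col_carrier pq] by (simp add: sum_blocks)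
  also have "\<dots> = (\<Sum>i<m. (B i * X i) $$ (p, q))"
  proof (rule sum.cong)
    fix i
    assume "i \<in> {..<m}"
    then have i: "i < m" by simp
    show "(\<Sum>a = 0..<n. block_row r n m B $$ (p, i * n + a) * block_col m n c X $$ (i * n + a, q)) =
        (B i * X i) $$ (p, q)"
      unfolding index_mult_mat_sum[OF assms(1)[OF i] assms(2)[OF i] pq]
      by (rule sum.cong) (use pq block_index_bound[OF i] in \<open>auto simp: block_row_def block_col_def\<close>)
  qed simp
  finally show "(block_row r n m B * block_col m n c X) $$ (p, q) =
      mat_sum r c (\<lambda>i. B i * X i) {..<m} $$ (p, q)"
    using pq by simp
qed (auto simp: block_row_def block_col_def)

lemma block_mat_eq_block_row:
  "block_mat k n M = block_row (k * n) n k (\<lambda>q. block_col k n n (\<lambda>p. M (p + 1) (q + 1)))"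
  by (rule eq_matI) (auto simp: block_mat_def block_row_def block_col_def block_index_split)

lemma block_mat_cong:
  assumes "\<And>p q. p < k \<Longrightarrow> q < k \<Longrightarrow> M (p + 1) (q + 1) = M' (p + 1) (q + 1)"
  shows "block_mat k n M = block_mat k n M'"
  unfolding block_mat_def by (rule eq_matI) (use assms in \<open>auto simp: block_index_split\<close>)

lemma block_row_mult_block_mat:
  assumes "\<And>i. i < k \<Longrightarrow> B i \<in> carrier_mat r n"
    and "\<And>p q. p < k \<Longrightarrow> q < k \<Longrightarrow> M (p + 1) (q + 1) \<in> carrier_mat n n"
  shows "block_row r n k B * block_mat k n M =
    block_row r n k (\<lambda>q. mat_sum r n (\<lambda>p. B p * M (p + 1) (q + 1)) {..<k})"
proof -
  have "block_row r n k B * block_mat k n M =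
      block_row r n k (\<lambda>q. block_row r n k B * block_col k n n (\<lambda>p. M (p + 1) (q + 1)))"
    unfolding block_mat_eq_block_row by (rule mult_block_row[of _ _ "k * n"]) auto
  also have "\<dots> = block_row r n k (\<lambda>q. mat_sum r n (\<lambda>p. B p * M (p + 1) (q + 1)) {..<k})"
    by (rule block_row_cong, rule block_row_mult_block_col) (use assms in auto)
  finally show ?thesis .
qed

lemma smooth_curve_block_row:
  assumes "open T" "\<And>i. i < m \<Longrightarrow> smooth_curve r n T (B i)"
  shows "smooth_curve r (m * n) T (\<lambda>t. block_row r n m (\<lambda>i. B i t))"
proof (rule smooth_curveI)
  fix p q
  assume pq: "p < r" "q < m * n"
  show "smooth_fun T (\<lambda>s. block_row r n m (\<lambda>i. B i s) $$ (p, q))"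
    using smooth_curveD(2)[OF assms(2), of "q div n" p "q mod n"] block_index_split[OF pq(2)] pq
    by (simp add: block_row_def)
qed simp

lemma smooth_curve_row_slice:
  assumes "open T" "smooth_curve (m * n) c T X" "i < m"
  shows "smooth_curve n c T (\<lambda>t. row_slice n i (X t))"
proof (rule smooth_curveI)
  show "row_slice n i (X t) \<in> carrier_mat n c" if "t \<in> T" for t
    by (rule row_slice_carrier[OF smooth_curveD(1)[OF assms(2) that]])
  show "smooth_fun T (\<lambda>s. row_slice n i (X s) $$ (p, q))" if pq: "p < n" "q < c" for p q
  proof (rule smooth_fun_cong[OF assms(1)])
    show "smooth_fun T (\<lambda>s. X s $$ (i * n + p, q))"
      by (rule smooth_curveD(2)[OF assms(2) block_index_bound[OF assms(3) pq(1)] pq(2)])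
    show "X s $$ (i * n + p, q) = row_slice n i (X s) $$ (p, q)" if "s \<in> T" for s
      using smooth_curveD(1)[OF assms(2) that] pq by (simp add: row_slice_def)
  qed
qed

text \<open>
  The coefficients expressing each column of \<open>X\<close> by those of \<open>M\<close> are collected as the columns of
  a matrix.
\<close>
lemma factor_through_col_space:
  fixes M :: "real mat"
  assumes "M \<in> carrier_mat N m" "X \<in> carrier_mat N c"
    and "set (cols X) \<subseteq> vec_space.col_space N M"
  obtains W where "W \<in> carrier_mat m c" "M * W = X"
proof -
  have "\<exists>w. w \<in> carrier_vec m \<and> M *\<^sub>v w = col X j" if "j < c" for j
  proof -
    have "col X j \<in> vec_space.col_space N M"
      using assms(2,3) that by (auto simp: cols_def)
    then show ?thesis
      using vec_space.col_space_eq[OF assms(1)] assms(1) by auto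
  qed
  then obtain w where w: "\<And>j. j < c \<Longrightarrow> w j \<in> carrier_vec m \<and> M *\<^sub>v w j = col X j"
    by metis
  let ?W = "Matrix.mat m c (\<lambda>(i, j). w j $ i)"
  have "M * ?W = X"
  proof (rule eq_matI)
    fix i j
    assume "i < dim_row X" "j < dim_col X"
    then have ij: "i < N" "j < c"
      using assms(2) by auto
    have "col ?W j = w j"
      using w[OF ij(2)] ij(2) by (intro eq_vecI) auto
    then have "(M * ?W) $$ (i, j) = (M *\<^sub>v w j) $ i"
      using assms(1) ij by simp
    also have "\<dots> = X $$ (i, j)"
      using w[OF ij(2)] assms(2) ij by simp
    finally show "(M * ?W) $$ (i, j) = X $$ (i, j)" .
  qed (use assms in auto)
  then show ?thesis
    using that[of ?W] by simp
qed

section \<open>The moving frame of a normal frame\<close>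

locale normal_frame_curve =
  fixes k n :: nat and T :: "real set" and A :: "real \<Rightarrow> real mat"
  assumes two_le_k: "2 \<le> k" and open_T: "open T" and normal: "normal_frame k n T A"
begin

abbreviation "N \<equiv> k * n"
text \<open>\<open>a i\<close> is the i-th derivative of the frame; the columns of \<open>frame t\<close> form a basis of \<open>\<real>\<^bsup>kn\<^esup>\<close>.\<close>
abbreviation "a \<equiv> \<lambda>i. mat_nderiv i A"
abbreviation "frame \<equiv> \<lambda>t. block_row N n k (\<lambda>i. a i t)"

lemma smooth_a: "smooth_curve N n T (a i)"
  using normal smooth_curve_mat_nderiv[OF open_T] by (simp add: normal_frame_def fanning_frame_def)

lemma a_carrier: "t \<in> T \<Longrightarrow> a i t \<in> carrier_mat N n"
  by (rule smooth_curveD(1)[OF smooth_a])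

lemma a_dim: "t \<in> T \<Longrightarrow> dim_row (a i t) = N" "t \<in> T \<Longrightarrow> dim_col (a i t) = n"
  using a_carrier by blast+

lemma a_has_deriv: "has_mat_deriv N n T (a i) (a (Suc i))"
  using has_mat_deriv_mat_deriv[OF smooth_a] by simp

lemma a_mult_carrier: "t \<in> T \<Longrightarrow> X \<in> carrier_mat n n \<Longrightarrow> a i t * X \<in> carrier_mat N n"
  by (rule mult_carrier_mat[OF a_carrier])

lemma a_mult_zero: "t \<in> T \<Longrightarrow> a i t * 0\<^sub>m n n = 0\<^sub>m N n"
  by (rule right_mult_zero_mat[OF a_carrier])

lemma smooth_frame: "smooth_curve N N T frame"
  by (rule smooth_curve_block_row[OF open_T smooth_a])

lemma frame_inverse:
  obtains C where "smooth_curve N N T C" "\<And>t. t \<in> T \<Longrightarrow> frame t * C t = 1\<^sub>m N"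
    "\<And>t. t \<in> T \<Longrightarrow> C t * frame t = 1\<^sub>m N"
proof -
  have "invertible_mat (frame t)" if "t \<in> T" for t
    using normal that by (simp add: normal_frame_def fanning_frame_def)
  from smooth_inverse_curve[OF open_T smooth_frame this] show ?thesis
    using that by metis
qed

text \<open>The columns of \<open>a 0 t, ..., a (k - 1) t\<close> span, so they determine an endomorphism.\<close>
lemma endo_eqI:
  assumes t: "t \<in> T" and L: "L \<in> carrier_mat N N" "L' \<in> carrier_mat N N"
    and eq: "\<And>i. i < k \<Longrightarrow> L * a i t = L' * a i t"
  shows "L = L'"
proof -
  obtain C where C: "smooth_curve N N T C" "frame t * C t = 1\<^sub>m N"
    using frame_inverse t by metis
  have Ct: "C t \<in> carrier_mat N N"
    by (rule smooth_curveD(1)[OF C(1) t])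
  have frame_eq: "L * frame t = L' * frame t"
    unfolding mult_block_row[OF L(1) a_carrier[OF t]] mult_block_row[OF L(2) a_carrier[OF t]]
    by (rule block_row_cong[OF eq])
  have "L = L * (frame t * C t)"
    using L by (simp add: C(2))
  also have "\<dots> = (L * frame t) * C t"
    by (rule assoc_mult_mat[symmetric, OF L(1) block_row_carrier Ct])
  also have "\<dots> = L' * (frame t * C t)"
    unfolding frame_eq by (rule assoc_mult_mat[OF L(2) block_row_carrier Ct])
  also have "\<dots> = L'"
    using L by (simp add: C(2))
  finally show ?thesis .
qed

text \<open>The columns of \<open>a 0 t, ..., a (k - 1) t\<close> are linearly independent.\<close>
lemma frame_coeffs_unique:
  assumes t: "t \<in> T" and X: "\<And>i. i < k \<Longrightarrow> X i \<in> carrier_mat n n"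
    and Y: "\<And>i. i < k \<Longrightarrow> Y i \<in> carrier_mat n n"
    and eq: "mat_sum N n (\<lambda>i. a i t * X i) {..<k} = mat_sum N n (\<lambda>i. a i t * Y i) {..<k}"
    and i: "i < k"
  shows "X i = Y i"
proof -
  obtain C where C: "smooth_curve N N T C" "C t * frame t = 1\<^sub>m N"
    using frame_inverse t by metis
  have Ct: "C t \<in> carrier_mat N N"
    by (rule smooth_curveD(1)[OF C(1) t])
  have cancel: "C t * (frame t * Z) = Z" if "Z \<in> carrier_mat N n" for Z
    using assoc_mult_mat[OF Ct block_row_carrier that, of "\<lambda>i. a i t"] that C(2) by simp
  have "block_col k n n X = C t * (frame t * block_col k n n X)"
    by (rule cancel[symmetric]) simp
  also have "frame t * block_col k n n X = frame t * block_col k n n Y"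
    using eq block_row_mult_block_col[OF a_carrier[OF t] X] block_row_mult_block_col[OF a_carrier[OF t] Y]
    by simp
  also have "C t * (frame t * block_col k n n Y) = block_col k n n Y"
    by (rule cancel) simp
  finally have "block_col k n n X = block_col k n n Y" .
  then show ?thesis
    using row_slice_block_col[of i k X n n] row_slice_block_col[of i k Y n n] i X Y by metis
qed

section \<open>The fundamental endomorphism\<close>

abbreviation "F \<equiv> fundamental_endo k n A"

text \<open>
  If \<open>C\<close> is the inverse of the frame matrix, then \<open>(0 | a\<^sub>0 | 2 a\<^sub>1 | ...) C\<close> satisfies the equations
  defining \<open>F\<close>, and it is smooth. The case \<open>F a\<^sub>0 = 0\<close> is included: there the factor \<open>real i\<close> is 0,
  whatever \<open>a (i - 1)\<close> is.
\<close>
lemma fundamental_endo_curve: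
  shows F_mult_a: "t \<in> T \<Longrightarrow> i < k \<Longrightarrow> F t * a i t = real i \<cdot>\<^sub>m a (i - 1) t"
    and smooth_F: "smooth_curve N N T F"
proof -
  obtain C where C: "smooth_curve N N T C" "\<And>t. t \<in> T \<Longrightarrow> C t * frame t = 1\<^sub>m N"
    using frame_inverse by metis
  let ?E = "\<lambda>t. block_row N n k (\<lambda>i. real i \<cdot>\<^sub>m a (i - 1) t) * C t"
  have smooth_E: "smooth_curve N N T ?E"
    by (intro smooth_curve_mult[of _ _ N] smooth_curve_block_row smooth_curve_smult smooth_a open_T C(1))
  have E_a: "?E t * a i t = real i \<cdot>\<^sub>m a (i - 1) t" if t: "t \<in> T" and i: "i < k" for t i
  proof (rule block_row_inject[OF _ i])
    note Et = smooth_curveD(1)[OF smooth_E t]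
    have "block_row N n k (\<lambda>i. ?E t * a i t) = ?E t * frame t"
      using mult_block_row[OF Et a_carrier[OF t]] by simp
    also have "\<dots> = block_row N n k (\<lambda>i. real i \<cdot>\<^sub>m a (i - 1) t) * (C t * frame t)"
      by (rule assoc_mult_mat[OF block_row_carrier smooth_curveD(1)[OF C(1) t] block_row_carrier])
    also have "\<dots> = block_row N n k (\<lambda>i. real i \<cdot>\<^sub>m a (i - 1) t)"
      using C(2)[OF t] right_mult_one_mat[OF block_row_carrier] by simp
    finally show "block_row N n k (\<lambda>i. ?E t * a i t) = block_row N n k (\<lambda>i. real i \<cdot>\<^sub>m a (i - 1) t)" .
    show "?E t * a i t \<in> carrier_mat N n" "real i \<cdot>\<^sub>m a (i - 1) t \<in> carrier_mat N n"
      using Et a_carrier[OF t] by auto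
  qed
  have F_eq_E: "F t = ?E t" if t: "t \<in> T" for t
    unfolding fundamental_endo_def
  proof (rule the_equality)
    show "?E t \<in> carrier_mat N N \<and> ?E t * A t = 0\<^sub>m N n \<and>
      (\<forall>i\<in>{1..k - 1}. ?E t * a i t = real i \<cdot>\<^sub>m a (i - 1) t)"
      using E_a[OF t, of 0] E_a[OF t] two_le_k smooth_curveD(1)[OF smooth_E t] a_carrier[OF t, of 0]
      by auto
    fix L
    assume L: "L \<in> carrier_mat N N \<and> L * A t = 0\<^sub>m N n \<and>
      (\<forall>i\<in>{1..k - 1}. L * a i t = real i \<cdot>\<^sub>m a (i - 1) t)"
    show "L = ?E t"
    proof (rule endo_eqI[OF t])
      fix i
      assume i: "i < k"
      show "L * a i t = ?E t * a i t"
      proof (cases "i = 0")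
        case True
        then show ?thesis
          using L E_a[OF t i] a_carrier[OF t, of 0] by auto
      next
        case False
        then show ?thesis
          using L i E_a[OF t i] by auto
      qed
    qed (use L smooth_curveD(1)[OF smooth_E t] in auto)
  qed
  show "t \<in> T \<Longrightarrow> i < k \<Longrightarrow> F t * a i t = real i \<cdot>\<^sub>m a (i - 1) t"
    using F_eq_E E_a by simp
  show "smooth_curve N N T F"
    by (rule smooth_curve_cong[OF open_T F_eq_E[symmetric] smooth_E])
qed

section \<open>The coefficients of the normal equation\<close>

abbreviation "h \<equiv> \<lambda>i t. normal_coeffs k n A t i"

text \<open>The frame coordinates of \<open>A\<^bsup>(k)\<^esup>\<close> when \<open>g\<close> are the coefficients of the normal equation.\<close>
definition top_coords :: "(nat \<Rightarrow> real mat) \<Rightarrow> nat \<Rightarrow> real mat" where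
  "top_coords g i = (if i < k - 1 then - real (k choose i) \<cdot>\<^sub>m g (k - 2 - i) else 0\<^sub>m n n)"

text \<open>
  The substitution \<open>i = k - j\<close>, under which \<open>(k choose j) = (k choose i)\<close>, turns the normal equation
  into a statement about coordinates in the frame.
\<close>
lemma normal_equation_iff:
  assumes t: "t \<in> T" and g: "\<And>i. g i \<in> carrier_mat n n"
  shows "a k t + mat_sum N n (\<lambda>j. real (k choose j) \<cdot>\<^sub>m (a (k - j) t * g (j - 2))) {2..k} = 0\<^sub>m N n
    \<longleftrightarrow> a k t = mat_sum N n (\<lambda>i. a i t * top_coords g i) {..<k}"
proof -
  have "(\<Sum>j = 2..k. (real (k choose j) \<cdot>\<^sub>m (a (k - j) t * g (j - 2))) $$ (p, q)) =
      - (\<Sum>i<k. (a i t * top_coords g i) $$ (p, q))" if pq: "p < N" "q < n" for p q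
  proof -
    have "(\<Sum>i<k. (a i t * top_coords g i) $$ (p, q)) = (\<Sum>i<k - 1. (a i t * top_coords g i) $$ (p, q))"
      using pq by (intro sum.mono_neutral_right) (auto simp: top_coords_def a_mult_zero[OF t])
    also have "\<dots> = (\<Sum>i<k - 1. - real (k choose i) * (a i t * g (k - 2 - i)) $$ (p, q))"
    proof (rule sum.cong)
      fix i
      assume "i \<in> {..<k - 1}"
      then show "(a i t * top_coords g i) $$ (p, q) = - real (k choose i) * (a i t * g (k - 2 - i)) $$ (p, q)"
        by (simp add: top_coords_def mult_smult_distrib[OF a_carrier[OF t] g]
            index_smult_carrier[OF a_mult_carrier[OF t g] pq] del: index_mult_mat index_smult_mat)
    qed simp
    also have "\<dots> = (\<Sum>j = 2..k. - real (k choose j) * (a (k - j) t * g (j - 2)) $$ (p, q))"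
    proof (rule sum.reindex_bij_witness[of _ "\<lambda>j. k - j" "\<lambda>i. k - i"])
      fix i
      assume "i \<in> {..<k - 1}"
      then have "k choose (k - i) = k choose i" "k - (k - i) = i" "k - i - 2 = k - 2 - i"
        by (auto simp: binomial_symmetric[of i k])
      then show "- real (k choose (k - i)) * (a (k - (k - i)) t * g (k - i - 2)) $$ (p, q) =
          - real (k choose i) * (a i t * g (k - 2 - i)) $$ (p, q)"
        by simp
    qed (use two_le_k in auto)
    finally show ?thesis
      by (simp add: sum_negf index_smult_carrier[OF a_mult_carrier[OF t g] pq]
          del: index_mult_mat index_smult_mat)
  qed
  note entries = this
  let ?S = "mat_sum N n (\<lambda>j. real (k choose j) \<cdot>\<^sub>m (a (k - j) t * g (j - 2))) {2..k}"
  have S: "?S $$ (p, q) = - mat_sum N n (\<lambda>i. a i t * top_coords g i) {..<k} $$ (p, q)"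
    if "p < N" "q < n" for p q
    using entries[OF that] that by (simp del: index_mult_mat index_smult_mat)
  show ?thesis
  proof
    assume eq: "a k t + ?S = 0\<^sub>m N n"
    show "a k t = mat_sum N n (\<lambda>i. a i t * top_coords g i) {..<k}"
    proof (rule eq_matI)
      fix p q
      assume "p < dim_row (mat_sum N n (\<lambda>i. a i t * top_coords g i) {..<k})"
        "q < dim_col (mat_sum N n (\<lambda>i. a i t * top_coords g i) {..<k})"
      then have pq: "p < N" "q < n" by auto
      show "a k t $$ (p, q) = mat_sum N n (\<lambda>i. a i t * top_coords g i) {..<k} $$ (p, q)"
        using arg_cong[OF eq, of "\<lambda>M. M $$ (p, q)"] S[OF pq] pq by (simp del: index_mat_sum)
    qed (use a_carrier[OF t] in auto)
  next
    assume eq: "a k t = mat_sum N n (\<lambda>i. a i t * top_coords g i) {..<k}"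
    show "a k t + ?S = 0\<^sub>m N n"
    proof (rule eq_matI)
      fix p q
      assume "p < dim_row (0\<^sub>m N n :: real mat)" "q < dim_col (0\<^sub>m N n :: real mat)"
      then have pq: "p < N" "q < n" by auto
      show "(a k t + ?S) $$ (p, q) = 0\<^sub>m N n $$ (p, q)"
        using arg_cong[OF eq, of "\<lambda>M. M $$ (p, q)"] S[OF pq] pq by (simp del: index_mat_sum)
    qed (use a_carrier[OF t] in auto)
  qed
qed

text \<open>
  The coordinates of the k-th derivative are the blocks of \<open>C a\<^sub>k\<close>, where \<open>C\<close> is the inverse of the
  frame matrix, so they are smooth. Normality provides another expression of \<open>a\<^sub>k\<close> that does not
  involve \<open>a\<^bsub>k-1\<^esub>\<close>; as coordinates are unique, the last one vanishes.
\<close>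
lemma top_coords_exist:
  "\<exists>X. (\<forall>i<k. smooth_curve n n T (X i)) \<and>
    (\<forall>t\<in>T. a k t = mat_sum N n (\<lambda>i. a i t * X i t) {..<k} \<and> X (k - 1) t = 0\<^sub>m n n)"
proof -
  obtain C where C: "smooth_curve N N T C" "\<And>t. t \<in> T \<Longrightarrow> frame t * C t = 1\<^sub>m N"
    using frame_inverse by metis
  let ?X = "\<lambda>i t. row_slice n i (C t * a k t)"
  have smooth: "smooth_curve N n T (\<lambda>t. C t * a k t)"
    by (rule smooth_curve_mult[OF open_T C(1) smooth_a])
  have smooth_X: "smooth_curve n n T (?X i)" if "i < k" for i
    by (rule smooth_curve_row_slice[OF open_T smooth that])
  have a_top: "a k t = mat_sum N n (\<lambda>i. a i t * ?X i t) {..<k}" if t: "t \<in> T" for t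
  proof -
    note Ct = smooth_curveD(1)[OF C(1) t]
    have "a k t = frame t * C t * a k t"
      using C(2)[OF t] left_mult_one_mat[OF a_carrier[OF t]] by simp
    also have "\<dots> = frame t * (C t * a k t)"
      by (rule assoc_mult_mat[OF block_row_carrier Ct a_carrier[OF t]])
    also have "\<dots> = frame t * block_col k n n (\<lambda>i. ?X i t)"
      using block_col_row_slice[OF smooth_curveD(1)[OF smooth t]] by simp
    also have "\<dots> = mat_sum N n (\<lambda>i. a i t * ?X i t) {..<k}"
      by (rule block_row_mult_block_col[OF a_carrier[OF t] smooth_curveD(1)[OF smooth_X t]])
    finally show ?thesis .
  qed
  have "?X (k - 1) t = 0\<^sub>m n n" if t: "t \<in> T" for t
  proof -
    (* a second expression of the k-th derivative, in which the last coordinate is 0 *)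
    have "set (cols (a k t)) \<subseteq> vec_space.col_space N (block_row N n (k - 1) (\<lambda>i. a i t))"
      using normal t by (simp add: normal_frame_def)
    then obtain W where W: "W \<in> carrier_mat ((k - 1) * n) n"
        "block_row N n (k - 1) (\<lambda>i. a i t) * W = a k t"
      using factor_through_col_space[OF block_row_carrier a_carrier[OF t]] by metis
    let ?Y = "\<lambda>i. if i < k - 1 then row_slice n i W else 0\<^sub>m n n"
    have Y: "?Y i \<in> carrier_mat n n" for i
      using row_slice_carrier[OF W(1)] by simp
    have "a k t = block_row N n (k - 1) (\<lambda>i. a i t) * block_col (k - 1) n n (\<lambda>i. row_slice n i W)"
      using W(2) block_col_row_slice[OF W(1)] by simp
    also have "\<dots> = mat_sum N n (\<lambda>i. a i t * row_slice n i W) {..<k - 1}"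
      by (rule block_row_mult_block_col[OF a_carrier[OF t] row_slice_carrier[OF W(1)]])
    also have "\<dots> = mat_sum N n (\<lambda>i. a i t * ?Y i) {..<k}"
      by (intro eq_matI) (auto intro!: sum.mono_neutral_cong_left simp: a_mult_zero[OF t] split: if_splits)
    finally have "mat_sum N n (\<lambda>i. a i t * ?X i t) {..<k} = mat_sum N n (\<lambda>i. a i t * ?Y i) {..<k}"
      using a_top[OF t] by simp
    from frame_coeffs_unique[OF t smooth_curveD(1)[OF smooth_X t] Y this, of "k - 1"]
    show ?thesis using two_le_k by simp
  qed
  with smooth_X a_top show ?thesis
    by (intro exI[of _ ?X]) blast
qed

text \<open>
  Up to the nonzero factors \<open>- (k choose i)\<close>, the coefficients of the normal equation are the
  coordinates of the k-th derivative, so they exist, are unique and inherit smoothness.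
\<close>
lemma normal_coeffs_curve:
  shows smooth_h: "smooth_curve n n T (h i)"
    and a_top: "t \<in> T \<Longrightarrow> a k t = mat_sum N n (\<lambda>i. a i t * top_coords (normal_coeffs k n A t) i) {..<k}"
proof -
  obtain X where X0: "\<forall>i<k. smooth_curve n n T (X i)"
    "\<forall>t\<in>T. a k t = mat_sum N n (\<lambda>i. a i t * X i t) {..<k} \<and> X (k - 1) t = 0\<^sub>m n n"
    using top_coords_exist by blast
  have X: "\<And>i. i < k \<Longrightarrow> smooth_curve n n T (X i)"
    "\<And>t. t \<in> T \<Longrightarrow> a k t = mat_sum N n (\<lambda>i. a i t * X i t) {..<k}"
    "\<And>t. t \<in> T \<Longrightarrow> X (k - 1) t = 0\<^sub>m n n"
    using X0(1) X0(2) by blast+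
  (* the normal equation solved for its coefficients; the value 0 beyond k - 2 is part of the
     definition of the family *)
  define g where "g = (\<lambda>i t. if i \<le> k - 2 then (- 1 / real (k choose (k - 2 - i))) \<cdot>\<^sub>m X (k - 2 - i) t else 0\<^sub>m n n)"
  have smooth_zero: "smooth_curve n n T (\<lambda>t. 0\<^sub>m n n)"
    by (rule smooth_curveI) (auto intro: smooth_fun_const open_T)
  have smooth_g: "smooth_curve n n T (g i)" for i
    using smooth_curve_smult[OF open_T X(1)[of "k - 2 - i"]] smooth_zero two_le_k
    by (cases "i \<le> k - 2") (auto simp: g_def)
  have g_coords: "top_coords (\<lambda>i. g i t) i = X i t" if "i < k" "t \<in> T" for i t
  proof (cases "i < k - 1")
    case True
    then have "k - 2 - i \<le> k - 2" "k - 2 - (k - 2 - i) = i"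
      by auto
    with True have "top_coords (\<lambda>i. g i t) i =
        - real (k choose i) \<cdot>\<^sub>m ((- 1 / real (k choose i)) \<cdot>\<^sub>m X i t)"
      unfolding top_coords_def g_def by presburger
    also have "\<dots> = X i t"
      using that(1) by (intro eq_matI) auto
    finally show ?thesis .
  next
    case False
    then have "i = k - 1" using that(1) by simp
    then show ?thesis
      using X(3)[OF that(2)] by (simp add: top_coords_def)
  qed
  have h_eq: "normal_coeffs k n A t = (\<lambda>i. g i t)" if t: "t \<in> T" for t
    unfolding normal_coeffs_def
  proof (rule the_equality)
    note g = smooth_curveD(1)[OF smooth_g t]
    have "a k t = mat_sum N n (\<lambda>i. a i t * top_coords (\<lambda>i. g i t) i) {..<k}"
      unfolding X(2)[OF t] by (rule mat_sum_cong) (use g_coords t in auto)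
    then show "(\<forall>i. g i t \<in> carrier_mat n n) \<and> (\<forall>i>k - 2. g i t = 0\<^sub>m n n) \<and>
      a k t + mat_sum N n (\<lambda>j. real (k choose j) \<cdot>\<^sub>m (a (k - j) t * g (j - 2) t)) {2..k} = 0\<^sub>m N n"
      using normal_equation_iff[OF t, of "\<lambda>i. g i t", OF g] g by (simp add: g_def)
    fix f
    assume f: "(\<forall>i. f i \<in> carrier_mat n n) \<and> (\<forall>i>k - 2. f i = 0\<^sub>m n n) \<and>
      a k t + mat_sum N n (\<lambda>j. real (k choose j) \<cdot>\<^sub>m (a (k - j) t * f (j - 2))) {2..k} = 0\<^sub>m N n"
    then have f_top: "a k t = mat_sum N n (\<lambda>i. a i t * top_coords f i) {..<k}"
      using normal_equation_iff[OF t, of f] by blast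
    have f_coords: "top_coords f i = X i t" if "i < k" for i
    proof (rule frame_coeffs_unique[OF t _ _ _ that])
      show "mat_sum N n (\<lambda>i. a i t * top_coords f i) {..<k} = mat_sum N n (\<lambda>i. a i t * X i t) {..<k}"
        using f_top X(2)[OF t] by simp
    qed (use f smooth_curveD(1)[OF X(1) t] in \<open>auto simp: top_coords_def\<close>)
    show "f = (\<lambda>i. g i t)"
    proof
      fix i
      show "f i = g i t"
      proof (cases "i \<le> k - 2")
        case True
        have idx: "k - 2 - i < k" "k - 2 - i < k - 1" "k - 2 - (k - 2 - i) = i"
          using two_le_k True by auto
        let ?c = "real (k choose (k - 2 - i))"
        have "X (k - 2 - i) t = - ?c \<cdot>\<^sub>m f i"
          using f_coords[OF idx(1)] idx(2,3) by (simp only: top_coords_def if_True)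
        then have "g i t = (- 1 / ?c) \<cdot>\<^sub>m (- ?c \<cdot>\<^sub>m f i)"
          using True by (simp only: g_def if_True)
        also have "\<dots> = f i"
          using idx(1) by (intro eq_matI) auto
        finally show ?thesis by (rule sym)
      qed (use f in \<open>auto simp: g_def\<close>)
    qed
  qed
  show "smooth_curve n n T (h i)"
    by (rule smooth_curve_cong[OF open_T _ smooth_g[of i]]) (simp add: h_eq)
  show "a k t = mat_sum N n (\<lambda>i. a i t * top_coords (normal_coeffs k n A t) i) {..<k}" if t: "t \<in> T"
    unfolding h_eq[OF t] unfolding X(2)[OF t] by (rule mat_sum_cong) (use g_coords t in auto)
qed

section \<open>The derivative of the fundamental endomorphism\<close>

lemma h_carrier: "t \<in> T \<Longrightarrow> h i t \<in> carrier_mat n n"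
  by (rule smooth_curveD(1)[OF smooth_h])

lemma h_has_deriv: "has_mat_deriv n n T (h i) (mat_deriv (h i))"
  by (rule has_mat_deriv_mat_deriv[OF smooth_h])

lemma mat_deriv_h_carrier: "t \<in> T \<Longrightarrow> mat_deriv (h i) t \<in> carrier_mat n n"
  by (rule has_mat_derivD(2)[OF h_has_deriv])

text \<open>
  A linear combination of \<open>a\<^sub>0, ..., a\<^bsub>m-1\<^esub>\<close>. The scalars are kept apart from the matrix coefficients
  because they are the binomial coefficients that have to be recombined.
\<close>
definition vertical_sum :: "nat \<Rightarrow> (nat \<Rightarrow> real) \<Rightarrow> (nat \<Rightarrow> real mat) \<Rightarrow> real \<Rightarrow> real mat" where
  "vertical_sum m c X t = mat_sum N n (\<lambda>i. c i \<cdot>\<^sub>m (a i t * X i)) {..<m}"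

lemma vertical_sum_carrier [simp]: "vertical_sum m c X t \<in> carrier_mat N n"
  by (simp add: vertical_sum_def)

lemma vertical_sum_dim [simp]: "dim_row (vertical_sum m c X t) = N" "dim_col (vertical_sum m c X t) = n"
  by (simp_all add: vertical_sum_def)

lemma index_vertical_sum:
  assumes "t \<in> T" "\<And>i. i < m \<Longrightarrow> X i \<in> carrier_mat n n" "p < N" "q < n"
  shows "vertical_sum m c X t $$ (p, q) = (\<Sum>i<m. c i * (a i t * X i) $$ (p, q))"
  using assms(3,4) index_smult_carrier[OF a_mult_carrier[OF assms(1,2)] assms(3,4)]
  by (simp add: vertical_sum_def del: index_smult_mat index_mult_mat)

lemma mult_vertical_sum:
  assumes t: "t \<in> T" and L: "L \<in> carrier_mat N N" and X: "\<And>i. i < m \<Longrightarrow> X i \<in> carrier_mat n n"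
  shows "L * vertical_sum m c X t = mat_sum N n (\<lambda>i. c i \<cdot>\<^sub>m (L * a i t * X i)) {..<m}"
proof -
  have "L * vertical_sum m c X t = mat_sum N n (\<lambda>i. L * (c i \<cdot>\<^sub>m (a i t * X i))) {..<m}"
    unfolding vertical_sum_def using mult_mat_sum[OF L, of "{..<m}"] a_mult_carrier[OF t X] by simp
  also have "\<dots> = mat_sum N n (\<lambda>i. c i \<cdot>\<^sub>m (L * a i t * X i)) {..<m}"
  proof (rule mat_sum_cong)
    fix i
    assume "i \<in> {..<m}"
    then have i: "i < m" by simp
    show "L * (c i \<cdot>\<^sub>m (a i t * X i)) = c i \<cdot>\<^sub>m (L * a i t * X i)"
      using mult_smult_distrib[OF L a_mult_carrier[OF t X[OF i]]]
        assoc_mult_mat[OF L a_carrier[OF t] X[OF i]] by simp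
  qed
  finally show ?thesis .
qed

text \<open>
  The derivative of \<open>F\<close> acts on the vertical space as the scalar \<open>-1\<close>; this carries the action over to
  combinations with matrix coefficients, which multiply from the other side.
\<close>
lemma mult_vertical_sum_eigen:
  assumes t: "t \<in> T" and L: "L \<in> carrier_mat N N" and X: "\<And>i. i < m \<Longrightarrow> X i \<in> carrier_mat n n"
    and eigen: "\<And>i. i < m \<Longrightarrow> L * a i t = x \<cdot>\<^sub>m a i t"
  shows "L * vertical_sum m c X t = x \<cdot>\<^sub>m vertical_sum m c X t"
proof -
  have "L * vertical_sum m c X t = mat_sum N n (\<lambda>i. c i \<cdot>\<^sub>m (L * a i t * X i)) {..<m}"
    by (rule mult_vertical_sum[OF t L X])
  also have "\<dots> = mat_sum N n (\<lambda>i. x \<cdot>\<^sub>m (c i \<cdot>\<^sub>m (a i t * X i))) {..<m}"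
  proof (rule mat_sum_cong)
    fix i
    assume "i \<in> {..<m}"
    then have i: "i < m" by simp
    have "L * a i t * X i = x \<cdot>\<^sub>m (a i t * X i)"
      unfolding eigen[OF i] by (rule mult_smult_assoc_mat[OF a_carrier[OF t] X[OF i]])
    then show "c i \<cdot>\<^sub>m (L * a i t * X i) = x \<cdot>\<^sub>m (c i \<cdot>\<^sub>m (a i t * X i))"
      by (intro eq_matI) auto
  qed
  also have "\<dots> = x \<cdot>\<^sub>m vertical_sum m c X t"
    unfolding vertical_sum_def by (rule smult_mat_sum[symmetric]) (use a_mult_carrier[OF t X] in auto)
  finally show ?thesis .
qed

lemma vertical_sum_has_deriv:
  assumes "\<And>i. i < m \<Longrightarrow> has_mat_deriv n n T (X i) (X' i)"
  shows "has_mat_deriv N n T (\<lambda>t. vertical_sum m c (\<lambda>i. X i t) t)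
    (\<lambda>t. mat_sum N n (\<lambda>i. c i \<cdot>\<^sub>m (a (Suc i) t * X i t + a i t * X' i t)) {..<m})"
  unfolding vertical_sum_def
  by (intro has_mat_deriv_mat_sum has_mat_deriv_smult has_mat_deriv_mult[OF open_T a_has_deriv assms]
      open_T) simp

lemma a_top_vertical_sum:
  "t \<in> T \<Longrightarrow> a k t = vertical_sum (k - 1) (\<lambda>i. - real (k choose i)) (\<lambda>i. h (k - 2 - i) t) t"
proof -
  assume t: "t \<in> T"
  have "mat_sum N n (\<lambda>i. a i t * top_coords (normal_coeffs k n A t) i) {..<Suc (k - 1)} =
      mat_sum N n (\<lambda>i. a i t * top_coords (normal_coeffs k n A t) i) {..<k - 1}"
    by (subst mat_sum_lessThan_Suc)
      (auto simp: top_coords_def a_mult_zero[OF t] right_add_zero_mat[OF mat_sum_carrier])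
  also have "\<dots> = vertical_sum (k - 1) (\<lambda>i. - real (k choose i)) (\<lambda>i. h (k - 2 - i) t) t"
    unfolding vertical_sum_def
    by (rule mat_sum_cong) (simp add: top_coords_def mult_smult_distrib[OF a_carrier[OF t] h_carrier[OF t]])
  finally show ?thesis
    using a_top[OF t] two_le_k by simp
qed

text \<open>The vertical summand in \<open>H = a\<^bsub>k-1\<^esub> + \<dots>\<close>.\<close>
definition vertical_part :: "real \<Rightarrow> real mat" where
  "vertical_part t = vertical_sum (k - 2) (\<lambda>i. real ((k - 1) choose i)) (\<lambda>i. h (k - 3 - i) t) t"

definition H :: "real \<Rightarrow> real mat" where
  "H t = a (k - 1) t + vertical_part t"

text \<open>
  Up to a binomial factor, this will be the block in row i (counted from 0) of the second to last
  column of the Jacobi matrix. The case \<open>i = k - 2\<close> is separate because \<open>h\<^bsub>-1\<^esub>\<close> has to be read as 0,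
  while \<open>k - 3 - i\<close> truncates to 0.
\<close>
definition jacobi_coeff :: "nat \<Rightarrow> real \<Rightarrow> real mat" where
  "jacobi_coeff i t = (if i = k - 2 then h 0 t else h (k - 2 - i) t - mat_deriv (h (k - 3 - i)) t)"

text \<open>The derivative of \<open>H\<close>, as \<open>H_has_deriv\<close> will show.\<close>
definition H' :: "real \<Rightarrow> real mat" where
  "H' t = vertical_sum (k - 1) (\<lambda>i. - real ((k - 1) choose i)) (\<lambda>i. jacobi_coeff i t) t"

lemma vertical_part_carrier [simp]: "vertical_part t \<in> carrier_mat N n"
  and H'_carrier [simp]: "H' t \<in> carrier_mat N n"
  by (simp_all add: vertical_part_def H'_def)

lemma vertical_part_dim [simp]: "dim_row (vertical_part t) = N" "dim_col (vertical_part t) = n"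
  by (simp_all add: vertical_part_def)

lemma H_carrier: "t \<in> T \<Longrightarrow> H t \<in> carrier_mat N n"
  using a_carrier by (simp add: H_def)

lemma jacobi_coeff_carrier: "t \<in> T \<Longrightarrow> jacobi_coeff i t \<in> carrier_mat n n"
  by (auto simp: jacobi_coeff_def intro!: minus_carrier_mat h_carrier mat_deriv_h_carrier)

text \<open>
  \<open>F\<close> lowers the index, and \<open>(i + 1) (k choose i + 1) = k (k-1 choose i)\<close> extracts the factor k.
\<close>
lemma F_mult_a_top:
  assumes t: "t \<in> T"
  shows "F t * a k t = (- real k) \<cdot>\<^sub>m vertical_part t"
proof -
  note Ft = smooth_curveD(1)[OF smooth_F t]
  have Fa: "F t * a i t * h (k - 2 - i) t = real i \<cdot>\<^sub>m (a (i - 1) t * h (k - 2 - i) t)" if "i < k - 1" for i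
    using F_mult_a[OF t, of i] that mult_smult_assoc_mat[OF a_carrier[OF t] h_carrier[OF t]] by simp
  have "F t * a k t = mat_sum N n (\<lambda>i. - real (k choose i) \<cdot>\<^sub>m (F t * a i t * h (k - 2 - i) t)) {..<k - 1}"
    unfolding a_top_vertical_sum[OF t] by (rule mult_vertical_sum[OF t Ft h_carrier[OF t]])
  also have "\<dots> = mat_sum N n
      (\<lambda>i. - real (k choose i) \<cdot>\<^sub>m (real i \<cdot>\<^sub>m (a (i - 1) t * h (k - 2 - i) t))) {..<k - 1}"
    by (rule mat_sum_cong) (simp only: Fa lessThan_iff)
  also have "\<dots> = (- real k) \<cdot>\<^sub>m vertical_part t"
  proof (rule eq_matI)
    fix p q
    assume "p < dim_row ((- real k) \<cdot>\<^sub>m vertical_part t)" "q < dim_col ((- real k) \<cdot>\<^sub>m vertical_part t)"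
    then have pq: "p < N" "q < n"
      by (auto simp: vertical_part_def)
    let ?x = "\<lambda>i j. (a i t * h j t) $$ (p, q)"
    have km: "k - 1 = Suc (k - 2)"
      using two_le_k by simp
    have "mat_sum N n (\<lambda>i. - real (k choose i) \<cdot>\<^sub>m
          (real i \<cdot>\<^sub>m (a (i - 1) t * h (k - 2 - i) t))) {..<k - 1} $$ (p, q) =
        (\<Sum>i<k - 1. - real (k choose i) * (real i * ?x (i - 1) (k - 2 - i)))"
      using pq by (simp add: index_smult_carrier[OF a_mult_carrier[OF t h_carrier[OF t]] pq]
          index_smult_carrier[OF smult_carrier_mat[OF a_mult_carrier[OF t h_carrier[OF t]]] pq]
          del: index_mult_mat index_smult_mat)
    also have "\<dots> = (\<Sum>i<k - 2. - real (k choose Suc i) * (real (Suc i) * ?x i (k - 2 - Suc i)))"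
      unfolding km by (subst sum.lessThan_Suc_shift) simp
    also have "\<dots> = (\<Sum>i<k - 2. - real k * (real ((k - 1) choose i) * ?x i (k - 3 - i)))"
    proof (rule sum.cong)
      fix i
      have "real (Suc i) * real (k choose Suc i) = real k * real ((k - 1) choose i)"
        unfolding of_nat_mult[symmetric] binomial_absorption ..
      moreover have "- c * (s * x) = - r * (d * x)" if "s * c = r * d" for c s x r d :: real
        using arg_cong[OF that, of "\<lambda>z. - z * x"] by (simp add: mult_ac)
      moreover have "k - 2 - Suc i = k - 3 - i" by simp
      ultimately show "- real (k choose Suc i) * (real (Suc i) * ?x i (k - 2 - Suc i)) =
          - real k * (real ((k - 1) choose i) * ?x i (k - 3 - i))"
        by (metis (no_types, lifting))
    qed simp
    also have "\<dots> = ((- real k) \<cdot>\<^sub>m vertical_part t) $$ (p, q)"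
      unfolding index_smult_carrier[OF vertical_part_carrier pq]
      unfolding vertical_part_def index_vertical_sum[OF t h_carrier[OF t] pq]
      by (simp add: sum_distrib_left)
    finally show "mat_sum N n (\<lambda>i. - real (k choose i) \<cdot>\<^sub>m
          (real i \<cdot>\<^sub>m (a (i - 1) t * h (k - 2 - i) t))) {..<k - 1} $$ (p, q) =
        ((- real k) \<cdot>\<^sub>m vertical_part t) $$ (p, q)" .
  qed (simp_all add: vertical_part_def)
  finally show ?thesis .
qed

abbreviation "F' \<equiv> mat_deriv F"
abbreviation "F'' \<equiv> mat_deriv F'"

lemma F_has_deriv: "has_mat_deriv N N T F F'"
  by (rule has_mat_deriv_mat_deriv[OF smooth_F])

lemma F'_has_deriv: "has_mat_deriv N N T F' F''"
  by (rule has_mat_deriv_mat_deriv[OF smooth_curve_mat_deriv[OF open_T smooth_F]])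

lemma F'_carrier: "t \<in> T \<Longrightarrow> F' t \<in> carrier_mat N N"
  and F''_carrier: "t \<in> T \<Longrightarrow> F'' t \<in> carrier_mat N N"
  using has_mat_derivD(1,2)[OF F'_has_deriv] by auto

text \<open>Derivative of \<open>F a\<^sub>i = i a\<^bsub>i-1\<^esub>\<close>, where \<open>F a\<^bsub>i+1\<^esub> = (i + 1) a\<^sub>i\<close> is known.\<close>
lemma F'_mult_a:
  assumes t: "t \<in> T" and i: "i < k - 1"
  shows "F' t * a i t = (- 1) \<cdot>\<^sub>m a i t"
proof -
  have "has_mat_deriv N n T (\<lambda>t. F t * a i t) (\<lambda>t. F' t * a i t + F t * a (Suc i) t)"
    by (rule has_mat_deriv_mult[OF open_T F_has_deriv a_has_deriv])
  moreover have "has_mat_deriv N n T (\<lambda>t. real i \<cdot>\<^sub>m a (i - 1) t) (\<lambda>t. real i \<cdot>\<^sub>m a (Suc (i - 1)) t)"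
    by (rule has_mat_deriv_smult[OF open_T a_has_deriv])
  ultimately have "F' t * a i t + F t * a (Suc i) t = real i \<cdot>\<^sub>m a (Suc (i - 1)) t"
    by (rule has_mat_deriv_unique[OF _ _ open_T _ t]) (use F_mult_a i in auto)
  moreover have "real i \<cdot>\<^sub>m a (Suc (i - 1)) t = real i \<cdot>\<^sub>m a i t"
    using a_carrier[OF t, of 0] a_carrier[OF t, of "Suc 0"] by (cases i) auto
  moreover have "F t * a (Suc i) t = real (Suc i) \<cdot>\<^sub>m a i t"
    using F_mult_a[OF t, of "Suc i"] i by simp
  ultimately have "F' t * a i t + real (Suc i) \<cdot>\<^sub>m a i t = real i \<cdot>\<^sub>m a i t"
    by metis
  from add_eq_imp_eq[OF this mult_carrier_mat[OF F'_carrier[OF t] a_carrier[OF t]]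
      smult_carrier_mat[OF a_carrier[OF t]]]
  have "F' t * a i t = real i \<cdot>\<^sub>m a i t + (- 1) \<cdot>\<^sub>m (real (Suc i) \<cdot>\<^sub>m a i t)" .
  also have "\<dots> = (- 1) \<cdot>\<^sub>m a i t"
    by (rule eq_matI) (auto simp: algebra_simps)
  finally show ?thesis .
qed

text \<open>The same derivative for \<open>i = k - 1\<close>, where \<open>F a\<^sub>k\<close> comes from the normal equation.\<close>
lemma F'_mult_a_last:
  assumes t: "t \<in> T"
  shows "F' t * a (k - 1) t = (real k - 1) \<cdot>\<^sub>m a (k - 1) t + real k \<cdot>\<^sub>m vertical_part t"
proof -
  have k: "Suc (k - 1) = k" "Suc (k - 1 - 1) = k - 1" "real (k - 1) = real k - 1"
    using two_le_k by auto
  have "has_mat_deriv N n T (\<lambda>t. F t * a (k - 1) t) (\<lambda>t. F' t * a (k - 1) t + F t * a (Suc (k - 1)) t)"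
    by (rule has_mat_deriv_mult[OF open_T F_has_deriv a_has_deriv])
  moreover have "has_mat_deriv N n T (\<lambda>t. real (k - 1) \<cdot>\<^sub>m a (k - 1 - 1) t)
      (\<lambda>t. real (k - 1) \<cdot>\<^sub>m a (Suc (k - 1 - 1)) t)"
    by (rule has_mat_deriv_smult[OF open_T a_has_deriv])
  ultimately have "F' t * a (k - 1) t + F t * a (Suc (k - 1)) t = real (k - 1) \<cdot>\<^sub>m a (Suc (k - 1 - 1)) t"
    by (rule has_mat_deriv_unique[OF _ _ open_T _ t]) (use F_mult_a two_le_k in auto)
  then have "F' t * a (k - 1) t + (- real k) \<cdot>\<^sub>m vertical_part t = (real k - 1) \<cdot>\<^sub>m a (k - 1) t"
    unfolding k F_mult_a_top[OF t] .
  from add_eq_imp_eq[OF this mult_carrier_mat[OF F'_carrier[OF t] a_carrier[OF t]]]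
  have "F' t * a (k - 1) t = (real k - 1) \<cdot>\<^sub>m a (k - 1) t + (- 1) \<cdot>\<^sub>m ((- real k) \<cdot>\<^sub>m vertical_part t)"
    by simp
  also have "(- 1) \<cdot>\<^sub>m ((- real k) \<cdot>\<^sub>m vertical_part t) = real k \<cdot>\<^sub>m vertical_part t"
    by (rule eq_matI) auto
  finally show ?thesis .
qed

text \<open>\<open>k H = a\<^bsub>k-1\<^esub> + F' a\<^bsub>k-1\<^esub>\<close>, and \<open>F'\<close> is \<open>-1\<close> on the vertical part of \<open>H\<close>.\<close>
lemma F'_mult_H:
  assumes t: "t \<in> T"
  shows "F' t * H t = (real k - 1) \<cdot>\<^sub>m H t"
proof -
  have "F' t * vertical_part t = (- 1) \<cdot>\<^sub>m vertical_part t"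
    unfolding vertical_part_def
    by (rule mult_vertical_sum_eigen[OF t F'_carrier[OF t] h_carrier[OF t] F'_mult_a[OF t]]) simp
  then have "F' t * H t = ((real k - 1) \<cdot>\<^sub>m a (k - 1) t + real k \<cdot>\<^sub>m vertical_part t) + (- 1) \<cdot>\<^sub>m vertical_part t"
    unfolding H_def using mult_add_distrib_mat[OF F'_carrier[OF t] a_carrier[OF t] vertical_part_carrier]
      F'_mult_a_last[OF t] by simp
  also have "\<dots> = (real k - 1) \<cdot>\<^sub>m H t"
    unfolding H_def by (intro eq_matI) (auto simp: algebra_simps a_dim[OF t])
  finally show ?thesis .
qed

text \<open>Unfolding reflection and projection, \<open>I - P = (F' + I) / k\<close>.\<close>
lemma horizontal_deriv_eq_H:
  assumes t: "t \<in> T"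
  shows "horizontal_deriv k n A t = H t"
proof -
  have "1\<^sub>m N - vertical_proj k n A t = (1 / real k) \<cdot>\<^sub>m (F' t + 1\<^sub>m N)"
    using F'_carrier[OF t] two_le_k unfolding vertical_proj_def fundamental_reflection_def
    by (intro eq_matI) (auto simp: field_simps)
  then have "horizontal_deriv k n A t = (1 / real k) \<cdot>\<^sub>m ((F' t + 1\<^sub>m N) * a (k - 1) t)"
    unfolding horizontal_deriv_def
    using mult_smult_assoc_mat[OF add_carrier_mat[OF one_carrier_mat] a_carrier[OF t]] by simp
  also have "(F' t + 1\<^sub>m N) * a (k - 1) t = F' t * a (k - 1) t + 1\<^sub>m N * a (k - 1) t"
    by (rule add_mult_distrib_mat[OF F'_carrier[OF t] one_carrier_mat a_carrier[OF t]])
  also have "\<dots> = (real k - 1) \<cdot>\<^sub>m a (k - 1) t + real k \<cdot>\<^sub>m vertical_part t + a (k - 1) t"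
    unfolding F'_mult_a_last[OF t] left_mult_one_mat[OF a_carrier[OF t]] ..
  also have "(1 / real k) \<cdot>\<^sub>m \<dots> = H t"
    unfolding H_def using two_le_k by (intro eq_matI) (auto simp: field_simps a_dim[OF t])
  finally show ?thesis .
qed

section \<open>The Jacobi endomorphism\<close>

text \<open>
  The derivative of \<open>H\<close> is \<open>a\<^sub>k + \<Sum>\<^sub>i (k-1 choose i) (a\<^bsub>i+1\<^esub> h\<^bsub>k-3-i\<^esub> + a\<^sub>i h'\<^bsub>k-3-i\<^esub>)\<close>. Shifting the index of the
  first half, the coefficient of \<open>a\<^sub>i h\<^bsub>k-2-i\<^esub>\<close> becomes \<open>(k-1 choose i-1) - (k choose i)\<close>, which is
  \<open>- (k-1 choose i)\<close> by Pascal's rule. In particular \<open>H'\<close> has no component along \<open>a\<^bsub>k-1\<^esub>\<close>.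
\<close>
lemma H_has_deriv: "has_mat_deriv N n T H H'"
proof (rule has_mat_deriv_cong[OF open_T])
  let ?c = "\<lambda>i. real ((k - 1) choose i)"
  let ?S = "\<lambda>t. mat_sum N n (\<lambda>i. ?c i \<cdot>\<^sub>m
      (a (Suc i) t * h (k - 3 - i) t + a i t * mat_deriv (h (k - 3 - i)) t)) {..<k - 2}"
  show "has_mat_deriv N n T (\<lambda>t. a (k - 1) t + vertical_part t) (\<lambda>t. a (Suc (k - 1)) t + ?S t)"
    unfolding vertical_part_def by (intro has_mat_deriv_add open_T a_has_deriv vertical_sum_has_deriv h_has_deriv)
  show "a (k - 1) t + vertical_part t = H t" for t
    by (simp add: H_def)
  show "a (Suc (k - 1)) t + ?S t = H' t" if t: "t \<in> T" for t
  proof (rule eq_matI)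
    fix p q
    assume "p < dim_row (H' t)" "q < dim_col (H' t)"
    then have pq: "p < N" "q < n"
      by (auto simp: H'_def)
    let ?x = "\<lambda>i j. (a i t * h j t) $$ (p, q)"
    let ?y = "\<lambda>i j. (a i t * mat_deriv (h j) t) $$ (p, q)"
    (* the coefficients of the shifted sum; they make it start at 0 like the sum for a k *)
    let ?b = "\<lambda>i. if i = 0 then 0 else real ((k - 1) choose (i - 1))"
    define m where "m = k - 2"
    have m: "k - 1 = Suc m" "k = Suc (Suc m)" "\<And>i. k - 3 - i = m - Suc i" "k - 2 = m"
      using two_le_k by (auto simp: m_def)
    have top: "a k t $$ (p, q) = (\<Sum>i<Suc m. - real (k choose i) * ?x i (m - i))"
      unfolding a_top_vertical_sum[OF t] index_vertical_sum[OF t h_carrier[OF t] pq] unfolding m(1,4) ..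
    have "(?c i \<cdot>\<^sub>m (a (Suc i) t * h (k - 3 - i) t + a i t * mat_deriv (h (k - 3 - i)) t)) $$ (p, q) =
        ?c i * ?x (Suc i) (m - Suc i) + ?c i * ?y i (m - Suc i)" for i
      unfolding index_smult_carrier[OF add_carrier_mat[OF a_mult_carrier[OF t mat_deriv_h_carrier[OF t]]] pq]
        index_add_carrier[OF a_mult_carrier[OF t h_carrier[OF t]]
          a_mult_carrier[OF t mat_deriv_h_carrier[OF t]] pq] m(3)
      by (rule distrib_left)
    then have "?S t $$ (p, q) = (\<Sum>i<m. ?c i * ?x (Suc i) (m - Suc i) + ?c i * ?y i (m - Suc i))"
      unfolding index_mat_sum[OF pq] m(4) by (rule sum.cong[OF refl])
    also have "\<dots> = (\<Sum>i<m. ?c i * ?x (Suc i) (m - Suc i)) + (\<Sum>i<m. ?c i * ?y i (m - Suc i))"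
      by (rule sum.distrib)
    also have "(\<Sum>i<m. ?c i * ?x (Suc i) (m - Suc i)) = (\<Sum>i<Suc m. ?b i * ?x i (m - i))"
      by (subst sum.lessThan_Suc_shift) simp
    finally have S: "?S t $$ (p, q) =
        (\<Sum>i<Suc m. ?b i * ?x i (m - i)) + (\<Sum>i<m. ?c i * ?y i (m - Suc i))" .
    have pascal: "- real (k choose i) + ?b i = - ?c i" for i
      using two_le_k by (cases i; cases k) auto
    have "(a (Suc (k - 1)) t + ?S t) $$ (p, q) = a k t $$ (p, q) + ?S t $$ (p, q)"
      using index_add_carrier[OF a_carrier[OF t] mat_sum_carrier pq] two_le_k by simp
    also have "\<dots> = (\<Sum>i<Suc m. (- real (k choose i) + ?b i) * ?x i (m - i)) +
        (\<Sum>i<m. ?c i * ?y i (m - Suc i))"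
      unfolding top S distrib_right sum.distrib by (rule add.assoc[symmetric])
    also have "\<dots> = (\<Sum>i<m. - ?c i * (?x i (m - i) - ?y i (m - Suc i))) + - ?c m * ?x m 0"
      unfolding pascal by (simp add: right_diff_distrib sum_subtractf sum_negf)
    also have "\<dots> = H' t $$ (p, q)"
    proof -
      have entry: "(a i t * jacobi_coeff i t) $$ (p, q) = ?x i (m - i) - ?y i (m - Suc i)" if "i < m" for i
      proof -
        have "jacobi_coeff i t = h (m - i) t - mat_deriv (h (m - Suc i)) t"
          unfolding jacobi_coeff_def m(3,4) using that by simp
        then show ?thesis
          using mult_minus_distrib_mat[OF a_carrier[OF t] h_carrier[OF t] mat_deriv_h_carrier[OF t]]
            index_minus_carrier[OF a_mult_carrier[OF t h_carrier[OF t]]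
              a_mult_carrier[OF t mat_deriv_h_carrier[OF t]] pq] by simp
      qed
      have "jacobi_coeff m t = h 0 t"
        by (simp add: jacobi_coeff_def m(4))
      moreover have "(\<Sum>i<m. - ?c i * (?x i (m - i) - ?y i (m - Suc i))) =
          (\<Sum>i<m. - ?c i * (a i t * jacobi_coeff i t) $$ (p, q))"
        by (rule sum.cong[OF refl]) (simp only: entry lessThan_iff)
      ultimately show ?thesis
        unfolding H'_def index_vertical_sum[OF t jacobi_coeff_carrier[OF t] pq] unfolding m(1)
        by (simp only: sum.lessThan_Suc)
    qed
    finally show "(a (Suc (k - 1)) t + ?S t) $$ (p, q) = H' t $$ (p, q)" .
  qed (simp_all add: H'_def)
qed

text \<open>Derivative of \<open>F' a\<^sub>i = - a\<^sub>i\<close>.\<close>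
lemma F''_mult_a_step:
  assumes t: "t \<in> T" and i: "i < k - 1"
  shows "F'' t * a i t = (- 1) \<cdot>\<^sub>m a (Suc i) t + (- 1) \<cdot>\<^sub>m (F' t * a (Suc i) t)"
proof -
  have "has_mat_deriv N n T (\<lambda>t. F' t * a i t) (\<lambda>t. F'' t * a i t + F' t * a (Suc i) t)"
    by (rule has_mat_deriv_mult[OF open_T F'_has_deriv a_has_deriv])
  moreover have "has_mat_deriv N n T (\<lambda>t. (- 1) \<cdot>\<^sub>m a i t) (\<lambda>t. (- 1) \<cdot>\<^sub>m a (Suc i) t)"
    by (rule has_mat_deriv_smult[OF open_T a_has_deriv])
  ultimately have "F'' t * a i t + F' t * a (Suc i) t = (- 1) \<cdot>\<^sub>m a (Suc i) t"
    by (rule has_mat_deriv_unique[OF _ _ open_T F'_mult_a[OF _ i] t])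
  from add_eq_imp_eq[OF this mult_carrier_mat[OF F''_carrier[OF t] a_carrier[OF t]]
      mult_carrier_mat[OF F'_carrier[OF t] a_carrier[OF t]]]
  show ?thesis .
qed

lemma F''_mult_a:
  assumes t: "t \<in> T" and i: "i < k - 2"
  shows "F'' t * a i t = 0\<^sub>m N n"
proof -
  have "F'' t * a i t = (- 1) \<cdot>\<^sub>m a (Suc i) t + (- 1) \<cdot>\<^sub>m ((- 1) \<cdot>\<^sub>m a (Suc i) t)"
    using F''_mult_a_step[OF t, of i] F'_mult_a[OF t, of "Suc i"] i by simp
  also have "\<dots> = 0\<^sub>m N n"
    using a_carrier[OF t, of "Suc i"] by (intro eq_matI) auto
  finally show ?thesis .
qed

lemma F''_mult_a_last:
  assumes t: "t \<in> T"
  shows "F'' t * a (k - 2) t = (- real k) \<cdot>\<^sub>m H t"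
proof -
  have "k - 2 < k - 1" "Suc (k - 2) = k - 1"
    using two_le_k by auto
  then have "F'' t * a (k - 2) t = (- 1) \<cdot>\<^sub>m a (k - 1) t +
      (- 1) \<cdot>\<^sub>m ((real k - 1) \<cdot>\<^sub>m a (k - 1) t + real k \<cdot>\<^sub>m vertical_part t)"
    using F''_mult_a_step[OF t, of "k - 2"] F'_mult_a_last[OF t] by simp
  also have "\<dots> = (- real k) \<cdot>\<^sub>m H t"
    unfolding H_def by (intro eq_matI) (auto simp: algebra_simps a_dim[OF t])
  finally show ?thesis .
qed

text \<open>Derivative of \<open>F' H = (k - 1) H\<close>; here \<open>F' H' = - H'\<close> because \<open>H'\<close> is vertical.\<close>
lemma F''_mult_H:
  assumes t: "t \<in> T"
  shows "F'' t * H t = real k \<cdot>\<^sub>m H' t"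
proof -
  have "has_mat_deriv N n T (\<lambda>t. F' t * H t) (\<lambda>t. F'' t * H t + F' t * H' t)"
    by (rule has_mat_deriv_mult[OF open_T F'_has_deriv H_has_deriv])
  moreover have "has_mat_deriv N n T (\<lambda>t. (real k - 1) \<cdot>\<^sub>m H t) (\<lambda>t. (real k - 1) \<cdot>\<^sub>m H' t)"
    by (rule has_mat_deriv_smult[OF open_T H_has_deriv])
  ultimately have "F'' t * H t + F' t * H' t = (real k - 1) \<cdot>\<^sub>m H' t"
    by (rule has_mat_deriv_unique[OF _ _ open_T F'_mult_H t])
  moreover have "F' t * H' t = (- 1) \<cdot>\<^sub>m H' t"
    unfolding H'_def by (rule mult_vertical_sum_eigen[OF t F'_carrier[OF t] jacobi_coeff_carrier[OF t] F'_mult_a[OF t]])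
  ultimately have "F'' t * H t + (- 1) \<cdot>\<^sub>m H' t = (real k - 1) \<cdot>\<^sub>m H' t"
    by simp
  from add_eq_imp_eq[OF this mult_carrier_mat[OF F''_carrier[OF t] H_carrier[OF t]]
      smult_carrier_mat[OF H'_carrier]]
  have "F'' t * H t = (real k - 1) \<cdot>\<^sub>m H' t + (- 1) \<cdot>\<^sub>m ((- 1) \<cdot>\<^sub>m H' t)" .
  also have "\<dots> = real k \<cdot>\<^sub>m H' t"
    by (intro eq_matI) (auto simp: algebra_simps)
  finally show ?thesis .
qed

text \<open>Of all the terms of \<open>H'\<close>, \<open>F''\<close> only sees the one along \<open>a\<^bsub>k-2\<^esub>\<close>, which is \<open>- (k - 1) a\<^bsub>k-2\<^esub> h\<^sub>0\<close>.\<close>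
lemma F''_mult_H':
  assumes t: "t \<in> T"
  shows "F'' t * H' t = (real k * (real k - 1)) \<cdot>\<^sub>m (H t * h 0 t)"
proof -
  let ?c = "\<lambda>i. - real ((k - 1) choose i)"
  let ?M = "\<lambda>i. ?c i \<cdot>\<^sub>m (F'' t * a i t * jacobi_coeff i t)"
  have k: "k - 1 = Suc (k - 2)" "?c (k - 2) = - (real k - 1)"
    using two_le_k binomial_symmetric[of "k - 2" "k - 1"] by auto
  note carrier = mult_carrier_mat[OF mult_carrier_mat[OF F''_carrier[OF t] a_carrier[OF t]] jacobi_coeff_carrier[OF t]]
  have zero: "mat_sum N n ?M {..<k - 2} = 0\<^sub>m N n"
  proof (rule mat_sum_eq_zero)
    fix i
    assume "i \<in> {..<k - 2}"
    then show "?M i = 0\<^sub>m N n"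
      using F''_mult_a[OF t, of i] left_mult_zero_mat[OF jacobi_coeff_carrier[OF t]] by simp
  qed
  have "F'' t * H' t = mat_sum N n ?M {..<Suc (k - 2)}"
    unfolding H'_def k(1)[symmetric] by (rule mult_vertical_sum[OF t F''_carrier[OF t] jacobi_coeff_carrier[OF t]])
  also have "\<dots> = 0\<^sub>m N n + ?M (k - 2)"
    unfolding zero[symmetric] by (rule mat_sum_lessThan_Suc) (rule smult_carrier_mat[OF carrier])
  also have "\<dots> = ?M (k - 2)"
    by (rule left_add_zero_mat[OF smult_carrier_mat[OF carrier]])
  also have "\<dots> = - (real k - 1) \<cdot>\<^sub>m ((- real k) \<cdot>\<^sub>m H t * h 0 t)"
    unfolding k(2) F''_mult_a_last[OF t] by (simp add: jacobi_coeff_def)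
  also have "(- real k) \<cdot>\<^sub>m H t * h 0 t = (- real k) \<cdot>\<^sub>m (H t * h 0 t)"
    by (rule mult_smult_assoc_mat[OF H_carrier[OF t] h_carrier[OF t]])
  also have "- (real k - 1) \<cdot>\<^sub>m ((- real k) \<cdot>\<^sub>m (H t * h 0 t)) = (real k * (real k - 1)) \<cdot>\<^sub>m (H t * h 0 t)"
    by (intro eq_matI) (auto simp: algebra_simps)
  finally show ?thesis .
qed

abbreviation "K \<equiv> jacobi_endo k n A"

lemma jacobi_endo_eq: "K t = (1 / (real k)\<^sup>2) \<cdot>\<^sub>m (F'' t * F'' t)"
  by (simp add: jacobi_endo_def numeral_2_eq_2 Let_def)

lemma K_carrier: "t \<in> T \<Longrightarrow> K t \<in> carrier_mat N N"
  using mult_carrier_mat[OF F''_carrier F''_carrier] by (simp add: jacobi_endo_eq)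

lemma K_mult:
  assumes t: "t \<in> T" and X: "X \<in> carrier_mat N n"
  shows "K t * X = (1 / (real k)\<^sup>2) \<cdot>\<^sub>m (F'' t * (F'' t * X))"
  unfolding jacobi_endo_eq
    mult_smult_assoc_mat[OF mult_carrier_mat[OF F''_carrier[OF t] F''_carrier[OF t]] X]
    assoc_mult_mat[OF F''_carrier[OF t] F''_carrier[OF t] X] ..

lemma K_mult_a:
  assumes t: "t \<in> T" and i: "i < k - 2"
  shows "K t * a i t = 0\<^sub>m N n"
  unfolding K_mult[OF t a_carrier[OF t]] F''_mult_a[OF t i] right_mult_zero_mat[OF F''_carrier[OF t]]
  by (rule eq_matI) auto

lemma K_mult_a_last:
  assumes t: "t \<in> T"
  shows "K t * a (k - 2) t = (- 1) \<cdot>\<^sub>m H' t"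
  unfolding K_mult[OF t a_carrier[OF t]] F''_mult_a_last[OF t]
    mult_smult_distrib[OF F''_carrier[OF t] H_carrier[OF t]] F''_mult_H[OF t]
  using two_le_k by (intro eq_matI) (auto simp: power2_eq_square)

lemma K_mult_H:
  assumes t: "t \<in> T"
  shows "K t * H t = (real k - 1) \<cdot>\<^sub>m (H t * h 0 t)"
  unfolding K_mult[OF t H_carrier[OF t]] F''_mult_H[OF t]
    mult_smult_distrib[OF F''_carrier[OF t] H'_carrier] F''_mult_H'[OF t]
  using two_le_k by (intro eq_matI) (auto simp: power2_eq_square)

definition basis :: "real \<Rightarrow> nat \<Rightarrow> real mat" where
  "basis t i = (if i = k - 1 then H t else a i t)"

lemma basis_carrier: "t \<in> T \<Longrightarrow> basis t i \<in> carrier_mat N n"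
  by (simp add: basis_def H_carrier a_carrier)

lemma mat_sum_basis_split:
  assumes t: "t \<in> T" and X: "\<And>i. i < k \<Longrightarrow> X i \<in> carrier_mat n n"
  shows "mat_sum N n (\<lambda>p. basis t p * X p) {..<k} =
    mat_sum N n (\<lambda>p. a p t * X p) {..<k - 1} + H t * X (k - 1)"
proof -
  have k: "Suc (k - 1) = k" using two_le_k by simp
  have "mat_sum N n (\<lambda>p. basis t p * X p) {..<Suc (k - 1)} =
      mat_sum N n (\<lambda>p. basis t p * X p) {..<k - 1} + basis t (k - 1) * X (k - 1)"
    by (rule mat_sum_lessThan_Suc) (rule mult_carrier_mat[OF basis_carrier[OF t] X], use two_le_k in simp)
  moreover have "mat_sum N n (\<lambda>p. basis t p * X p) {..<k - 1} = mat_sum N n (\<lambda>p. a p t * X p) {..<k - 1}"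
    by (rule mat_sum_cong) (simp add: basis_def)
  ultimately show ?thesis
    unfolding k by (simp add: basis_def)
qed

text \<open>
  Since \<open>H\<close> differs from \<open>a\<^bsub>k-1\<^esub>\<close> by a vertical sum, a unipotent block matrix \<open>M\<close> carries the new
  basis to the frame.
\<close>
lemma basis_invertible:
  assumes t: "t \<in> T"
  shows "invertible_mat (block_row N n k (basis t))"
proof -
  obtain C where C: "smooth_curve N N T C" "frame t * C t = 1\<^sub>m N"
    using frame_inverse t by metis
  have Ct: "C t \<in> carrier_mat N N"
    by (rule smooth_curveD(1)[OF C(1) t])
  let ?B = "block_row N n k (basis t)"
  (* the last column expresses a (k - 1) as H minus its vertical part *)
  define M where "M = (\<lambda>p q. if q = k then
      (if p = k then 1\<^sub>m n
       else if p < k - 1 then - real ((k - 1) choose (p - 1)) \<cdot>\<^sub>m h (k - 2 - p) t else 0\<^sub>m n n)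
    else if p = q then 1\<^sub>m n else 0\<^sub>m n n)"
  have M: "M p q \<in> carrier_mat n n" for p q
    using h_carrier[OF t] by (simp add: M_def)
  have column: "mat_sum N n (\<lambda>p. basis t p * M (p + 1) (q + 1)) {..<k} = a q t" if q: "q < k" for q
  proof (cases "q = k - 1")
    case True
    have k1: "k - 1 = Suc (k - 2)"
      using two_le_k by simp
    have "mat_sum N n (\<lambda>p. a p t * M (p + 1) (q + 1)) {..<k - 1} =
        mat_sum N n (\<lambda>p. a p t * M (p + 1) (q + 1)) {..<k - 2} + a (k - 2) t * M (k - 2 + 1) (q + 1)"
      unfolding k1 by (rule mat_sum_lessThan_Suc[OF a_mult_carrier[OF t M]])
    also have "M (k - 2 + 1) (q + 1) = 0\<^sub>m n n"
    proof -
      have idx: "q + 1 = k" "k - 2 + 1 = k - 1" "k - 1 \<noteq> k"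
        using True two_le_k by auto
      show ?thesis
        unfolding M_def idx(1,2) using idx(3) by simp
    qed
    also have "mat_sum N n (\<lambda>p. a p t * M (p + 1) (q + 1)) {..<k - 2} + a (k - 2) t * 0\<^sub>m n n =
        mat_sum N n (\<lambda>p. a p t * M (p + 1) (q + 1)) {..<k - 2}"
      unfolding a_mult_zero[OF t] by (rule right_add_zero_mat[OF mat_sum_carrier])
    also have "\<dots> = mat_sum N n (\<lambda>p. (- 1) \<cdot>\<^sub>m
        (real ((k - 1) choose p) \<cdot>\<^sub>m (a p t * h (k - 3 - p) t))) {..<k - 2}"
    proof (rule mat_sum_cong)
      fix p
      assume "p \<in> {..<k - 2}"
      then have idx: "q + 1 = k" "k - 2 - (p + 1) = k - 3 - p" "p + 1 - 1 = p" "p + 1 \<noteq> k" "p + 1 < k - 1"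
        using True two_le_k by auto
      then have "M (p + 1) (q + 1) = - real ((k - 1) choose p) \<cdot>\<^sub>m h (k - 3 - p) t"
        unfolding M_def idx(1-3) by simp
      then have "a p t * M (p + 1) (q + 1) =
          - real ((k - 1) choose p) \<cdot>\<^sub>m (a p t * h (k - 3 - p) t)"
        using mult_smult_distrib[OF a_carrier[OF t] h_carrier[OF t]] by simp
      also have "\<dots> = (- 1) \<cdot>\<^sub>m (real ((k - 1) choose p) \<cdot>\<^sub>m (a p t * h (k - 3 - p) t))"
        by (intro eq_matI) auto
      finally show "a p t * M (p + 1) (q + 1) =
          (- 1) \<cdot>\<^sub>m (real ((k - 1) choose p) \<cdot>\<^sub>m (a p t * h (k - 3 - p) t))" .
    qed
    also have "\<dots> = (- 1) \<cdot>\<^sub>m vertical_part t"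
      unfolding vertical_part_def vertical_sum_def
      by (rule smult_mat_sum[symmetric, OF smult_carrier_mat[OF a_mult_carrier[OF t h_carrier[OF t]]]])
    finally have "mat_sum N n (\<lambda>p. a p t * M (p + 1) (q + 1)) {..<k - 1} = (- 1) \<cdot>\<^sub>m vertical_part t" .
    then show ?thesis
      unfolding mat_sum_basis_split[OF t M]
      using True two_le_k H_carrier[OF t] a_carrier[OF t, of "k - 1"]
      by (intro eq_matI) (auto simp: M_def H_def)
  next
    case False
    have "basis t p * M (p + 1) (q + 1) = (if p = q then a q t else 0\<^sub>m N n)" for p
      using False q right_mult_zero_mat[OF basis_carrier[OF t]] right_mult_one_mat[OF a_carrier[OF t]]
      by (auto simp: M_def basis_def)
    then show ?thesis
      using mat_sum_delta[of "{..<k}" q "a q t" N n] q a_carrier[OF t] by simp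
  qed
  have "?B * block_mat k n M = frame t"
    unfolding block_row_mult_block_mat[OF basis_carrier[OF t] M] by (rule block_row_cong[OF column])
  then have "?B * (block_mat k n M * C t) = 1\<^sub>m N"
    using assoc_mult_mat[OF block_row_carrier block_mat_carrier Ct] C(2) by metis
  moreover from this have "(block_mat k n M * C t) * ?B = 1\<^sub>m N"
    by (rule mat_mult_left_right_inverse[OF block_row_carrier mult_carrier_mat[OF block_mat_carrier Ct]])
  ultimately show ?thesis
    unfolding invertible_mat_def inverts_mat_def using Ct
    by (auto simp: block_row_def block_mat_def intro!: exI[of _ "block_mat k n M * C t"])
qed

text \<open>
  Read column by column, the claim is \<open>K a\<^sub>i = 0\<close> for \<open>i < k - 2\<close>, \<open>K a\<^bsub>k-2\<^esub> = - H'\<close> and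
  \<open>K H = (k - 1) H h\<^sub>0\<close>. The matrix \<open>M\<close> is the displayed one with the index j replaced by
  \<open>i = k - j\<close>, using \<open>(k-1 choose j-1) = (k-1 choose i)\<close>; the diagonal block in column \<open>k - 1\<close> is the
  case \<open>i = k - 2\<close>.
\<close>
lemma jacobi_endo_matrix:
  assumes t: "t \<in> T"
  shows "K t * block_row N n k (basis t) = block_row N n k (basis t) * jacobi_block_mat k n (h 0) h t"
proof -
  define M where "M = (\<lambda>p q. if q = k - 1 \<and> p < k then real ((k - 1) choose (p - 1)) \<cdot>\<^sub>m jacobi_coeff (p - 1) t
    else if q = k \<and> p = k then (real k - 1) \<cdot>\<^sub>m h 0 t else 0\<^sub>m n n)"
  have M: "M p q \<in> carrier_mat n n" for p q
    using h_carrier[OF t] jacobi_coeff_carrier[OF t] by (simp add: M_def)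
  have jacobi: "jacobi_block_mat k n (h 0) h t = block_mat k n M"
    unfolding jacobi_block_mat_def
  proof (rule block_mat_cong)
    fix p q
    assume pq: "p < k" "q < k"
    have "real ((k - 1) choose (k - 2)) = real k - 1"
      using two_le_k binomial_symmetric[of "k - 2" "k - 1"] by auto
    note last = this
    have "k - 1 choose (k - (p + 1) + 1 - 1) = k - 1 choose p"
      using binomial_symmetric[of p "k - 1"] pq by simp
    moreover have "k - (p + 1) + 1 - 2 = k - 2 - p" "k - (p + 1) + 1 - 3 = k - 3 - p"
      using pq by auto
    ultimately have let_eq: "(let j = k - (p + 1) + 1
          in real (k - 1 choose (j - 1)) \<cdot>\<^sub>m (h (j - 2) t - mat_deriv (h (j - 3)) t)) =
        real (k - 1 choose p) \<cdot>\<^sub>m (h (k - 2 - p) t - mat_deriv (h (k - 3 - p)) t)"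
      unfolding Let_def by (simp only:)
    consider "q = k - 1" | "q = k - 2" "p = k - 1" | "q = k - 2" "p = k - 2"
      | "q = k - 2" "p < k - 2" | "q < k - 2"
      using pq by linarith
    then show "(if p + 1 = q + 1 \<and> (p + 1 = k - 1 \<or> p + 1 = k) then (real k - 1) \<cdot>\<^sub>m h 0 t
       else if q + 1 = k - 1 \<and> p + 1 \<le> k - 2
            then let j = k - (p + 1) + 1
                 in real (k - 1 choose (j - 1)) \<cdot>\<^sub>m (h (j - 2) t - mat_deriv (h (j - 3)) t)
            else 0\<^sub>m n n) = M (p + 1) (q + 1)"
    proof cases
      case 1
      then have "q + 1 = k" "k \<noteq> k - 1" "p + 1 = k - 1 \<or> p + 1 = k \<longleftrightarrow> p + 1 = k - 1 \<or> p = q"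
        using two_le_k by auto
      then show ?thesis
        unfolding let_eq by (auto simp: M_def)
    next
      case 2
      then have "q + 1 = k - 1" "p + 1 = k" "k \<noteq> k - 1" "\<not> k \<le> k - 2"
        using two_le_k by auto
      then show ?thesis
        unfolding let_eq by (simp add: M_def)
    next
      case 3
      then have "q + 1 = k - 1" "p + 1 = k - 1" "k - 1 < k" "k - 1 - 1 = k - 2"
        using two_le_k by auto
      then show ?thesis
        using last unfolding let_eq by (simp add: M_def jacobi_coeff_def)
    next
      case 4
      then have "q + 1 = k - 1" "p + 1 \<noteq> k - 1" "p + 1 \<noteq> k" "p + 1 < k" "p + 1 \<le> k - 2" "p \<noteq> k - 2"
        using two_le_k by auto
      then show ?thesis
        unfolding let_eq by (simp add: M_def jacobi_coeff_def)
    next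
      case 5
      then have "q + 1 \<noteq> k - 1" "q + 1 \<noteq> k"
        by auto
      then show ?thesis
        unfolding let_eq by (auto simp: M_def)
    qed
  qed
  have column: "K t * basis t q = mat_sum N n (\<lambda>p. basis t p * M (p + 1) (q + 1)) {..<k}" if q: "q < k" for q
  proof -
    consider "q < k - 2" | "q = k - 2" | "q = k - 1" using q by linarith
    then show ?thesis
    proof cases
      case 1
      then have "q + 1 \<noteq> k - 1" "q + 1 \<noteq> k"
        by auto
      then have "M (p + 1) (q + 1) = 0\<^sub>m n n" for p
        by (simp add: M_def)
      then have "mat_sum N n (\<lambda>p. basis t p * M (p + 1) (q + 1)) {..<k} = 0\<^sub>m N n"
        using right_mult_zero_mat[OF basis_carrier[OF t]] by (simp add: mat_sum_eq_zero)
      moreover have "q \<noteq> k - 1"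
        using 1 by linarith
      then have "basis t q = a q t"
        by (simp add: basis_def)
      ultimately show ?thesis
        using K_mult_a[OF t 1] \<open>basis t q = a q t\<close> by simp
    next
      case 2
      have "M (k - 1 + 1) (q + 1) = 0\<^sub>m n n"
        using 2 two_le_k by (auto simp: M_def)
      then have "mat_sum N n (\<lambda>p. basis t p * M (p + 1) (q + 1)) {..<k} =
          mat_sum N n (\<lambda>p. a p t * M (p + 1) (q + 1)) {..<k - 1}"
        unfolding mat_sum_basis_split[OF t M]
        using right_mult_zero_mat[OF H_carrier[OF t]] right_add_zero_mat[OF mat_sum_carrier] by simp
      also have "\<dots> = mat_sum N n (\<lambda>p. (- 1) \<cdot>\<^sub>m (- real ((k - 1) choose p) \<cdot>\<^sub>m (a p t * jacobi_coeff p t))) {..<k - 1}"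
      proof (rule mat_sum_cong)
        fix p
        assume "p \<in> {..<k - 1}"
        then have "q + 1 = k - 1" "p + 1 < k"
          using 2 two_le_k by auto
        then have "M (p + 1) (q + 1) = real ((k - 1) choose p) \<cdot>\<^sub>m jacobi_coeff p t"
          by (simp add: M_def)
        then have "a p t * M (p + 1) (q + 1) = real ((k - 1) choose p) \<cdot>\<^sub>m (a p t * jacobi_coeff p t)"
          using mult_smult_distrib[OF a_carrier[OF t] jacobi_coeff_carrier[OF t]] by simp
        also have "\<dots> = (- 1) \<cdot>\<^sub>m (- real ((k - 1) choose p) \<cdot>\<^sub>m (a p t * jacobi_coeff p t))"
          by (intro eq_matI) auto
        finally show "a p t * M (p + 1) (q + 1) =
            (- 1) \<cdot>\<^sub>m (- real ((k - 1) choose p) \<cdot>\<^sub>m (a p t * jacobi_coeff p t))" .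
      qed
      also have "\<dots> = (- 1) \<cdot>\<^sub>m H' t"
        unfolding H'_def vertical_sum_def
        by (rule smult_mat_sum[symmetric, OF smult_carrier_mat[OF a_mult_carrier[OF t jacobi_coeff_carrier[OF t]]]])
      also have "\<dots> = K t * basis t q"
      proof -
        have "q \<noteq> k - 1"
          using 2 two_le_k by linarith
        then show ?thesis
          using K_mult_a_last[OF t] 2 by (simp add: basis_def)
      qed
      finally show ?thesis by (rule sym)
    next
      case 3
      have "M (p + 1) (q + 1) = 0\<^sub>m n n" if "p < k - 1" for p
        using 3 that by (auto simp: M_def)
      then have "mat_sum N n (\<lambda>p. a p t * M (p + 1) (q + 1)) {..<k - 1} = 0\<^sub>m N n"
        by (intro mat_sum_eq_zero) (simp add: a_mult_zero[OF t])
      moreover have "M (k - 1 + 1) (q + 1) = (real k - 1) \<cdot>\<^sub>m h 0 t"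
        using 3 two_le_k by (simp add: M_def)
      moreover have "H t * ((real k - 1) \<cdot>\<^sub>m h 0 t) = (real k - 1) \<cdot>\<^sub>m (H t * h 0 t)"
        by (rule mult_smult_distrib[OF H_carrier[OF t] h_carrier[OF t]])
      moreover have "(real k - 1) \<cdot>\<^sub>m (H t * h 0 t) \<in> carrier_mat N n"
        using mult_carrier_mat[OF H_carrier[OF t] h_carrier[OF t]] by simp
      ultimately show ?thesis
        unfolding mat_sum_basis_split[OF t M]
        using K_mult_H[OF t] 3 by (simp add: basis_def)
    qed
  qed
  have "K t * block_row N n k (basis t) = block_row N n k (\<lambda>q. K t * basis t q)"
    by (rule mult_block_row[OF K_carrier[OF t] basis_carrier[OF t]])
  also have "\<dots> = block_row N n k (basis t) * block_mat k n M"
    unfolding block_row_mult_block_mat[OF basis_carrier[OF t] M] by (rule block_row_cong[OF column])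
  finally show ?thesis
    unfolding jacobi .
qed

end

theorem theorem3p10:
  fixes k n :: nat and T :: "real set" and A :: "real \<Rightarrow> real mat"
    and \<kappa> :: "real \<Rightarrow> real mat" and h :: "nat \<Rightarrow> real \<Rightarrow> real mat"
  assumes "n \<ge> 1" and "k \<ge> 2"
    and "open T" and "is_interval T"
    and "normal_frame k n T A"
  defines "\<kappa> \<equiv> \<lambda>t. (1 / 2) \<cdot>\<^sub>m schwarzian k n A t"
    and "h \<equiv> \<lambda>i t. normal_coeffs k n A t i"
  shows "\<forall>t\<in>T. matrix_in_basis (k * n)
           (jacobi_endo k n A t)
           (block_row (k * n) n k
              (\<lambda>i. if i = k - 1 then horizontal_deriv k n A t else mat_nderiv i A t))
           (jacobi_block_mat k n \<kappa> h t)"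
proof
  fix t
  assume t: "t \<in> T"
  interpret normal_frame_curve k n T A
    by unfold_locales fact+
  (* the Schwarzian was defined as twice the coefficient h 0 *)
  have "(1 / 2 :: real) \<cdot>\<^sub>m (2 \<cdot>\<^sub>m X) = X" for X :: "real mat"
    by (rule eq_matI) auto
  then have \<kappa>: "\<kappa> = h 0"
    by (simp add: \<kappa>_def h_def schwarzian_def fun_eq_iff)
  have basis: "block_row (k * n) n k (\<lambda>i. if i = k - 1 then horizontal_deriv k n A t else mat_nderiv i A t) =
      block_row (k * n) n k (basis t)"
    by (rule block_row_cong) (simp add: basis_def horizontal_deriv_eq_H[OF t])
  show "matrix_in_basis (k * n) (jacobi_endo k n A t)
      (block_row (k * n) n k (\<lambda>i. if i = k - 1 then horizontal_deriv k n A t else mat_nderiv i A t))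
      (jacobi_block_mat k n \<kappa> h t)"
    unfolding matrix_in_basis_def basis \<kappa>
    using K_carrier[OF t] basis_invertible[OF t] jacobi_endo_matrix[OF t]
    by (simp add: h_def jacobi_block_mat_def)
qed

end
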